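(* Let $M,N$ be integers and let $\phi\in\mathcal{D}_N^M$ be an orthogonal scaling function (of the MRA it generates) with $\widehat\phi(0)\ne0$. Then $\operatorname{supp}\widehat\phi\subset B_0(0)$.
   Context: $p$ is a prime, $\mathbb{Q}_p$ the field of $p$-adic numbers with norm $|\cdot|_p$. The fractional part of $x=p^{\gamma}\sum_{j\ge0}x_jp^j$ ($x_j\in\{0,\dots,p-1\}$, $x_0\ne0$) is $\{x\}_p=p^{\gamma}\sum_{j=0}^{-\gamma-1}x_jp^j$, $\{0\}_p=0$; $\chi_p(x)=e^{2\pi i\{x\}_p}$; $I_p=\{a\in\mathbb{Q}_p:\{a\}_p=a\}$; $B_\gamma(a)=\{x:|x-a|_p\le p^\gamma\}$. $dx$ is Haar measure with $B_0(0)$ of measure $1$; $\widehat f(\xi)=\int\chi_p(\xi x)f(x)\,dx$. A test function is a locally constant compactly supported complex function. $\mathcal{D}_N^M$ is the set of test functions $\phi$ that are $p^M$-periodic ($\phi(x+p^M)=\phi(x)$) and supported in $B_N(0)$; equivalently, locally constant $\phi$ with $\operatorname{supp}\phi\subset B_N(0)$, $\operatorname{supp}\widehat\phi\subset B_M(0)$. A collection of closed subspaces $V_j\subset L^2(\mathbb{Q}_p)$, $j\in\mathbb{Z}$, is an MRA if: (a) $V_j\subset V_{j+1}$; (b) $\bigcup_jV_j$ is dense in $L^2(\mathbb{Q}_p)$; (c) $\bigcap_jV_j=\{0\}$; (d) $f(\cdot)\in V_j\iff f(p^{-1}\cdot)\in V_{j+1}$; (e) there is $\phi\in V_0$ with $V_0=\overline{\operatorname{span}\{\phi(x-a):a\in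 I_p\}}$ (a scaling function). A scaling function $\phi$ is orthogonal if $\{\phi(x-a):a\in I_p\}$ is an orthonormal basis of $V_0$. *)

theory Defs
  imports "HOL-Analysis.Analysis" "HOL-Computational_Algebra.Factorial_Ring"
begin

text \<open>Model of the p-adic numbers: a field 'a with a function nrm which is
  (up to isometric isomorphism, uniquely) the completion of the rationals
  with respect to the p-adic absolute value.\<close>

definition padic_val_rat :: "nat \<Rightarrow> rat \<Rightarrow> int" where
  "padic_val_rat p q = (case quotient_of q of (a, b) \<Rightarrow>
      int (multiplicity (int p) a) - int (multiplicity (int p) b))"

definition padic_abs_rat :: "nat \<Rightarrow> rat \<Rightarrow> real" where
  "padic_abs_rat p q = (if q = 0 then 0 else real p powi (- padic_val_rat p q))"

definition is_Qp :: "nat \<Rightarrow> ('a::field_char_0 \<Rightarrow> real) \<Rightarrow> bool" where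
  "is_Qp p nrm \<longleftrightarrow> prime p
     \<and> (\<forall>x. nrm x \<ge> 0) \<and> (\<forall>x. nrm x = 0 \<longleftrightarrow> x = 0)
     \<and> (\<forall>x y. nrm (x * y) = nrm x * nrm y)
     \<and> (\<forall>x y. nrm (x + y) \<le> max (nrm x) (nrm y))
     \<and> (\<forall>q. nrm (of_rat q) = padic_abs_rat p q)
     \<and> (\<forall>X. (\<forall>e>0. \<exists>K. \<forall>m\<ge>K. \<forall>n\<ge>K. nrm (X m - X n) < e)
            \<longrightarrow> (\<exists>x. (\<lambda>n. nrm (X n - x)) \<longlonglongrightarrow> 0))
     \<and> (\<forall>x e. e > 0 \<longrightarrow> (\<exists>q. nrm (x - of_rat q) < e))"

definition pball :: "nat \<Rightarrow> ('a::field \<Rightarrow> real) \<Rightarrow> int \<Rightarrow> 'a \<Rightarrow> 'a set" where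
  "pball p nrm g a = {x. nrm (x - a) \<le> real p powi g}"

definition fracp :: "nat \<Rightarrow> ('a::field_char_0 \<Rightarrow> real) \<Rightarrow> 'a \<Rightarrow> rat" where
  "fracp p nrm x = (if x = 0 then 0 else
     (THE r. \<exists>(g::int) (d::nat \<Rightarrow> nat). (\<forall>j. d j < p) \<and> d 0 \<noteq> 0
        \<and> (\<lambda>n. nrm (of_nat p powi g * (\<Sum>j<n. of_nat (d j) * of_nat p ^ j) - x))
             \<longlonglongrightarrow> 0
        \<and> r = of_nat p powi g * (\<Sum>j<nat (- g). of_nat (d j) * of_nat p ^ j)))"

definition chi :: "nat \<Rightarrow> ('a::field_char_0 \<Rightarrow> real) \<Rightarrow> 'a \<Rightarrow> complex" where
  "chi p nrm x = cis (2 * pi * real_of_rat (fracp p nrm x))"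

definition Ip :: "nat \<Rightarrow> ('a::field_char_0 \<Rightarrow> real) \<Rightarrow> 'a set" where
  "Ip p nrm = {a. of_rat (fracp p nrm a) = a}"

definition nrm_open :: "('a::ab_group_add \<Rightarrow> real) \<Rightarrow> 'a set \<Rightarrow> bool" where
  "nrm_open nrm U \<longleftrightarrow> (\<forall>x\<in>U. \<exists>e>0. \<forall>y. nrm (y - x) < e \<longrightarrow> y \<in> U)"

definition is_haar :: "nat \<Rightarrow> ('a::field_char_0 \<Rightarrow> real) \<Rightarrow> 'a measure \<Rightarrow> bool" where
  "is_haar p nrm mu \<longleftrightarrow> space mu = UNIV
     \<and> sets mu = sigma_sets UNIV {U. nrm_open nrm U}
     \<and> (\<forall>A\<in>sets mu. \<forall>a. emeasure mu ((\<lambda>x. a + x) ` A) = emeasure mu A)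
     \<and> emeasure mu (pball p nrm 0 0) = 1"

definition fourier :: "nat \<Rightarrow> ('a::field_char_0 \<Rightarrow> real) \<Rightarrow> 'a measure
     \<Rightarrow> ('a \<Rightarrow> complex) \<Rightarrow> 'a \<Rightarrow> complex" where
  "fourier p nrm mu f xi = (LINT x|mu. chi p nrm (xi * x) * f x)"

text \<open>Locally constant, compactly (= boundedly, in Q_p) supported functions.\<close>
definition test_fun :: "('a::ab_group_add \<Rightarrow> real) \<Rightarrow> ('a \<Rightarrow> complex) \<Rightarrow> bool" where
  "test_fun nrm f \<longleftrightarrow> (\<forall>x. \<exists>e>0. \<forall>y. nrm (y - x) < e \<longrightarrow> f y = f x)
     \<and> (\<exists>R. \<forall>x. f x \<noteq> 0 \<longrightarrow> nrm x \<le> R)"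

definition DNM :: "nat \<Rightarrow> ('a::field_char_0 \<Rightarrow> real) \<Rightarrow> int \<Rightarrow> int \<Rightarrow> ('a \<Rightarrow> complex) set" where
  "DNM p nrm N M = {f. test_fun nrm f
     \<and> (\<forall>x. f (x + of_nat p powi M) = f x)
     \<and> (\<forall>x. f x \<noteq> 0 \<longrightarrow> x \<in> pball p nrm N 0)}"

text \<open>L^2 notions (functions, closed subspaces are closed under a.e. modification).\<close>
definition sqint :: "'a measure \<Rightarrow> ('a \<Rightarrow> complex) \<Rightarrow> bool" where
  "sqint mu f \<longleftrightarrow> f \<in> borel_measurable mu \<and> integrable mu (\<lambda>x. (cmod (f x))\<^sup>2)"

definition l2norm :: "'a measure \<Rightarrow> ('a \<Rightarrow> complex) \<Rightarrow> real" where
  "l2norm mu f = sqrt (LINT x|mu. (cmod (f x))\<^sup>2)"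

definition l2inner :: "'a measure \<Rightarrow> ('a \<Rightarrow> complex) \<Rightarrow> ('a \<Rightarrow> complex) \<Rightarrow> complex" where
  "l2inner mu f g = (LINT x|mu. f x * cnj (g x))"

definition closed_subspace :: "'a measure \<Rightarrow> ('a \<Rightarrow> complex) set \<Rightarrow> bool" where
  "closed_subspace mu V \<longleftrightarrow> V \<subseteq> {f. sqint mu f}
     \<and> (\<lambda>x. 0) \<in> V
     \<and> (\<forall>f\<in>V. \<forall>g\<in>V. (\<lambda>x. f x + g x) \<in> V)
     \<and> (\<forall>c. \<forall>f\<in>V. (\<lambda>x. c * f x) \<in> V)
     \<and> (\<forall>F g. (\<forall>n. F n \<in> V) \<longrightarrow> sqint mu g
            \<longrightarrow> (\<lambda>n. l2norm mu (\<lambda>x. F n x - g x)) \<longlonglongrightarrow> 0 \<longrightarrow> g \<in> V)"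

definition cspan :: "('a \<Rightarrow> complex) set \<Rightarrow> ('a \<Rightarrow> complex) set" where
  "cspan S = {f. \<exists>F c. finite F \<and> F \<subseteq> S \<and> f = (\<lambda>x. \<Sum>g\<in>F. c g * g x)}"

definition l2closure :: "'a measure \<Rightarrow> ('a \<Rightarrow> complex) set \<Rightarrow> ('a \<Rightarrow> complex) set" where
  "l2closure mu S = {g. sqint mu g \<and> (\<exists>F. (\<forall>n. F n \<in> S)
       \<and> (\<lambda>n. l2norm mu (\<lambda>x. F n x - g x)) \<longlonglongrightarrow> 0)}"

definition scaling_fun :: "nat \<Rightarrow> ('a::field_char_0 \<Rightarrow> real) \<Rightarrow> 'a measure
     \<Rightarrow> (int \<Rightarrow> ('a \<Rightarrow> complex) set) \<Rightarrow> ('a \<Rightarrow> complex) \<Rightarrow> bool" where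
  "scaling_fun p nrm mu V phi \<longleftrightarrow> phi \<in> V 0
     \<and> V 0 = l2closure mu (cspan {(\<lambda>x. phi (x - a)) | a. a \<in> Ip p nrm})"

definition is_MRA :: "nat \<Rightarrow> ('a::field_char_0 \<Rightarrow> real) \<Rightarrow> 'a measure
     \<Rightarrow> (int \<Rightarrow> ('a \<Rightarrow> complex) set) \<Rightarrow> bool" where
  "is_MRA p nrm mu V \<longleftrightarrow> (\<forall>j. closed_subspace mu (V j))
     \<and> (\<forall>j. V j \<subseteq> V (j + 1))
     \<and> (\<forall>f. sqint mu f \<longrightarrow> (\<forall>e>0. \<exists>j. \<exists>g\<in>V j. l2norm mu (\<lambda>x. f x - g x) < e))
     \<and> (\<forall>f. (\<forall>j. f \<in> V j) \<longrightarrow> (AE x in mu. f x = 0))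
     \<and> (\<forall>j f. f \<in> V j \<longleftrightarrow> (\<lambda>x. f (inverse (of_nat p) * x)) \<in> V (j + 1))
     \<and> (\<exists>phi. scaling_fun p nrm mu V phi)"

definition orth_scaling_fun :: "nat \<Rightarrow> ('a::field_char_0 \<Rightarrow> real) \<Rightarrow> 'a measure
     \<Rightarrow> (int \<Rightarrow> ('a \<Rightarrow> complex) set) \<Rightarrow> ('a \<Rightarrow> complex) \<Rightarrow> bool" where
  "orth_scaling_fun p nrm mu V phi \<longleftrightarrow> scaling_fun p nrm mu V phi
     \<and> (\<forall>a\<in>Ip p nrm. \<forall>b\<in>Ip p nrm.
          l2inner mu (\<lambda>x. phi (x - a)) (\<lambda>x. phi (x - b)) = (if a = b then 1 else 0))"

end

theory Submission
  imports Defs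
begin

text \<open>On the group of balls of radius $p^{-M}$ inside $B_N(0)$, which is cyclic of order
  $q = p^{N+M}$, the Fourier transform of $\phi$ is a polynomial function $F$ on the $q$-th roots of
  unity, with $z = \chi_p(\xi / p^N)$. Let $E$ be the set of roots with $F \neq 0$, so $1 \in E$.
  The inclusion $V_0 \subset V_1$ gives, for $0 \le s < p^N$, polynomials $P_s$ of degree less than
  $p^{N+1}$ with $p z^s F(z) = P_s(z) F(z^p)$ (where $F$ is extended by $0$ off the
  $q$-th roots of unity). If $|E| > p^N$, the relation $P_s = z^s P_0$, valid on the $p |E|$ points
  with $z^p \in E$, is an identity of polynomials, so $\deg P_0 \le (p - 1) p^N$; but $P_0$ vanishes
  at the $(p - 1) |E|$ points with $z^p \in E$, $z \notin E$. Hence $|E| \le p^N$. For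
  $1 \neq z \in E$ the polynomial $Q = \prod_{w \in E, w \neq z} (X - w)$ then has degree less than
  $p^N$, and orthonormality of the translates determines its coefficients up to a factor as $z^{-t}$. Now $Q(1) = 0$ says
  $\sum_{t < p^N} z^{-t} = 0$, so $\chi_p(\xi) = z^{p^N} = 1$, that is, $|\xi|_p \le 1$.\<close>

section \<open>Refinable sequences and roots of unity\<close>

lemma sum_lessThan_shift:
  fixes f :: "int \<Rightarrow> 'b::ab_group_add"
  assumes "\<And>k. f (k + int L) = f k"
  shows "(\<Sum>k<L. f (int k - int s)) = (\<Sum>k<L. f (int k))"
proof (induction s)
  case (Suc s)
  define g where "g k = f (k - int (Suc s))" for k
  have g: "g (k + int L) = g k" for k
    using assms[of "k - int (Suc s)"] by (simp add: g_def algebra_simps)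
  have "(\<Sum>k<L. g (int k)) + g (int L) = g 0 + (\<Sum>k<L. g (int k + 1))"
    using sum.lessThan_Suc[of "\<lambda>k. g (int k)" L] sum.lessThan_Suc_shift[of "\<lambda>k. g (int k)" L]
    by (simp add: algebra_simps)
  with g[of 0] have "(\<Sum>k<L. g (int k)) = (\<Sum>k<L. g (int k + 1))" by simp
  also have "\<dots> = (\<Sum>k<L. f (int k - int s))" by (simp add: g_def)
  finally show ?case using Suc by (simp add: g_def)
qed simp

lemma sum_lessThan_mult:
  fixes f :: "nat \<Rightarrow> 'b::comm_monoid_add"
  shows "(\<Sum>k<m * n. f k) = (\<Sum>i<m. \<Sum>k<n. f (i * n + k))"
proof (induction m)
  case (Suc m)
  have "{..<Suc m * n} = {..<m * n} \<union> {m * n..<m * n + n}" by auto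
  then have "(\<Sum>k<Suc m * n. f k) = (\<Sum>k<m * n. f k) + (\<Sum>k=m * n..<m * n + n. f k)"
    by (simp add: sum.union_disjoint ivl_disj_int)
  also have "(\<Sum>k=m * n..<m * n + n. f k) = (\<Sum>k<n. f (m * n + k))"
    using sum.shift_bounds_nat_ivl[of f 0 "m * n" n] by (simp add: atLeast0LessThan add.commute)
  finally show ?case by (simp add: Suc)
qed simp

lemma periodic_add_mult:
  fixes f :: "int \<Rightarrow> 'b"
  assumes "\<And>k. f (k + int L) = f k"
  shows "f (k + int i * int L) = f k"
proof (induction i)
  case (Suc i)
  have "f (k + int (Suc i) * int L) = f ((k + int i * int L) + int L)" by (simp add: algebra_simps)
  then show ?case using assms Suc by simp
qed simp

lemma cnj_unity:
  assumes "(w::complex) ^ n = 1" "n > 0"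
  shows "w * cnj w = 1"
  using norm_power[of w n] assms
  by (metis complex_norm_square norm_one of_real_1 one_power2 power_eq_1_iff neq0_conv abs_norm_cancel norm_ge_zero)

text \<open>Multiplication by the primitive root \<open>z\<close> permutes the roots and multiplies
  the sum by \<open>z ^ k * cnj z ^ l\<close>, which differs from 1 unless k = l; hence the sum
  vanishes.\<close>

lemma sum_roots_unity_powers:
  assumes "k < n" "l < n"
  shows "(\<Sum>w | w ^ n = 1. (w::complex) ^ k * cnj w ^ l) = (if k = l then of_nat n else 0)"
proof (cases "k = l")
  case True
  have n: "n > 0" using assms by simp
  have "(\<Sum>w | w ^ n = 1. (w::complex) ^ k * cnj w ^ l) = (\<Sum>w::complex | w ^ n = 1. 1)"
    using True n cnj_unity by (intro sum.cong) (auto simp flip: power_mult_distrib)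
  then show ?thesis using True card_roots_unity_eq[OF n] by simp
next
  case False
  have n: "n > 0" using assms by simp
  let ?S = "{w::complex. w ^ n = 1}"
  define z where "z = cis (2 * pi / n)"
  have zp: "z ^ k = cis (2 * pi * k / n)" for k :: nat
    unfolding z_def Complex.DeMoivre by (simp add: field_simps)
  have z1: "z ^ n = 1" using n by (simp add: zp)
  have ne: "z ^ k \<noteq> z ^ l"
    using Complex.bij_betw_roots_unity[OF n] assms False unfolding zp bij_betw_def inj_on_def by blast
  have zc: "z * cnj z = 1" using cnj_unity[OF z1 n] .
  have a: "z ^ k * cnj z ^ l \<noteq> 1"
  proof
    assume "z ^ k * cnj z ^ l = 1"
    then have "z ^ k * (cnj z ^ l * z ^ l) = z ^ l" by (simp add: algebra_simps)
    moreover have "cnj z ^ l * z ^ l = 1" using zc by (simp add: mult.commute flip: power_mult_distrib)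
    ultimately show False using ne by simp
  qed
  have bij: "bij_betw ((*) z) ?S ?S"
  proof (rule bij_betw_byWitness[where f' = "(*) (cnj z)"])
    have "cnj z * (z * a) = (z * cnj z) * a" "z * (cnj z * a) = (z * cnj z) * a" for a
      by (simp_all only: ac_simps)
    then show "\<forall>a\<in>?S. cnj z * (z * a) = a" "\<forall>a\<in>?S. z * (cnj z * a) = a"
      using zc by simp_all
    show "(*) z ` ?S \<subseteq> ?S" using z1 by (auto simp: power_mult_distrib)
    have "cnj z ^ n = 1" using z1 by (metis complex_cnj_one complex_cnj_power)
    then show "(*) (cnj z) ` ?S \<subseteq> ?S" by (auto simp: power_mult_distrib)
  qed
  have "(\<Sum>w\<in>?S. w ^ k * cnj w ^ l) = (\<Sum>w\<in>?S. (z * w) ^ k * cnj (z * w) ^ l)"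
    by (rule sum.reindex_bij_betw[OF bij, symmetric])
  also have "\<dots> = z ^ k * cnj z ^ l * (\<Sum>w\<in>?S. w ^ k * cnj w ^ l)"
    by (simp add: power_mult_distrib sum_distrib_left algebra_simps)
  finally have "(1 - z ^ k * cnj z ^ l) * (\<Sum>w\<in>?S. w ^ k * cnj w ^ l) = 0"
    by (simp only: left_diff_distrib mult_1_left diff_self)
  then show ?thesis using False a by auto
qed

section \<open>Bounding a spectrum by polynomial degrees\<close>

lemma poly_lessThan:
  assumes "degree P < n" shows "poly P (x::'b::comm_semiring_1) = (\<Sum>i<n. coeff P i * x ^ i)"
proof -
  have "(\<Sum>i<n. coeff P i * x ^ i) = (\<Sum>i\<le>degree P. coeff P i * x ^ i)"
    using assms by (intro sum.mono_neutral_right) (auto simp: coeff_eq_0 not_le)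
  then show ?thesis by (simp add: poly_altdef)
qed

lemma poly_eqI_card:
  fixes P Q :: "'b::idom poly"
  assumes "finite A" "\<And>x. x \<in> A \<Longrightarrow> poly P x = poly Q x" "degree P < card A" "degree Q < card A"
  shows "P = Q"
proof (rule ccontr)
  assume "P \<noteq> Q"
  then have ne: "P - Q \<noteq> 0" by simp
  have "card A \<le> card {x. poly (P - Q) x = 0}"
    using assms(2) by (intro card_mono poly_roots_finite ne) auto
  also have "\<dots> \<le> degree (P - Q)" by (rule card_poly_roots_bound[OF ne])
  also have "\<dots> < card A" using degree_diff_le_max[of P Q] assms(3,4) by (simp add: less_le_trans)
  finally show False by simp
qed

text \<open>The bound plays the degrees of the \<open>P s\<close> against the p |E| points of the
  preimage \<open>E1\<close>. Here \<open>P s\<close> is the mask polynomial of the translate by s,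
  and \<open>zero\<close> says that the mask kills every frequency of \<open>E1\<close> outside the
  spectrum \<open>E\<close>.\<close>

lemma card_spectrum_le:
  fixes E :: "complex set" and P :: "nat \<Rightarrow> complex poly"
  assumes p: "p \<ge> 2" and fin: "finite E" "0 \<notin> E" "1 \<in> E"
    and deg: "\<And>s. s < n \<Longrightarrow> degree (P s) < p * n" and n: "n > 0"
    and P: "\<And>s w. s < n \<Longrightarrow> w ^ p \<in> E \<Longrightarrow> poly (P s) w = w ^ s * poly (P 0) w"
    and zero: "\<And>w. w ^ p \<in> E \<Longrightarrow> w \<notin> E \<Longrightarrow> poly (P 0) w = 0"
    and one: "poly (P 0) 1 \<noteq> 0" and sub: "\<And>w. w \<in> E \<Longrightarrow> w ^ p \<in> E"
  shows "card E \<le> n"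
proof (rule ccontr)
  assume "\<not> card E \<le> n"
  then have big: "card E \<ge> Suc n" by simp
  define E1 where "E1 = {w. w ^ p \<in> E}"
  have E1: "E1 = (\<Union>z\<in>E. {w. w ^ p = z})" by (auto simp: E1_def)
  have fin1: "finite E1" unfolding E1
    using fin p by (intro finite_UN_I) (auto intro!: finite_nth_roots)
  \<comment> \<open>The fibres of the p-th power map are disjoint, and each has exactly p points
    because 0 is not in \<open>E\<close>.\<close>
  have "card E1 = (\<Sum>z\<in>E. card {w. w ^ p = z})" unfolding E1
    using fin p by (intro card_UN_disjoint) (auto intro!: finite_nth_roots)
  also have "\<dots> = (\<Sum>z\<in>E. p)"
    using fin p by (intro sum.cong refl card_nth_roots) auto
  finally have c1: "card E1 = p * card E" by simp
  have c1': "card E1 \<ge> p * n + p" using mult_le_mono2[OF big, of p] c1 by simp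
  have P0: "P 0 \<noteq> 0" using one by auto
  \<comment> \<open>Induction keeps the degree of X^s P_0 below |E1|: once this polynomial is
    identified with \<open>P s\<close>, its degree is below p n, and one more factor X still stays
    under p n + p.\<close>
  have shift: "P s = monom 1 s * P 0" if "s < n" for s
    using that
  proof (induction s)
    case (Suc s)
    have d: "degree (monom 1 (Suc s) * P 0) = Suc (degree (P s))"
      using Suc P0 by (simp add: degree_mult_eq degree_monom_eq)
    show ?case
    proof (rule poly_eqI_card[OF fin1])
      fix w assume "w \<in> E1"
      then show "poly (P (Suc s)) w = poly (monom 1 (Suc s) * P 0) w"
        using P[OF Suc.prems] by (simp add: E1_def poly_monom)
    next
      show "degree (P (Suc s)) < card E1" using deg[OF Suc.prems] c1' by simp
      show "degree (monom 1 (Suc s) * P 0) < card E1"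
        unfolding d using deg[of s] Suc.prems c1' p by simp
    qed
  qed simp
  have "degree (P (n - 1)) = n - 1 + degree (P 0)"
    using shift[of "n - 1"] n P0 by (simp add: degree_mult_eq degree_monom_eq)
  \<comment> \<open>From n - 1 + deg P_0 < p n; the strict inequality makes up for the index
    stopping at n - 1.\<close>
  then have d0: "degree (P 0) + n \<le> p * n" using deg[of "n - 1"] n by simp
  have "E \<subseteq> E1" using sub by (auto simp: E1_def)
  then have "card (E1 - E) + card E = p * card E"
    using card_mono[OF fin1, of E] fin c1 by (simp add: card_Diff_subset)
  moreover have "card (E1 - E) \<le> card {w. poly (P 0) w = 0}"
    using zero by (intro card_mono poly_roots_finite P0) (auto simp: E1_def)
  moreover have "card {w. poly (P 0) w = 0} \<le> degree (P 0)" by (rule card_poly_roots_bound[OF P0])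
  ultimately have "p * card E \<le> degree (P 0) + card E" by simp
  with d0 have "(p - 1) * card E \<le> (p - 1) * n" by (simp add: diff_mult_distrib)
  then show False using big p by simp
qed

section \<open>The refinement equation and orthogonality on the Fourier side\<close>

text \<open>Both sides are summed against w^k over the common period p q. On the left this gives p
  blocks of length q, hence a geometric sum in w^q, equal to p if w^q = 1 and to 0 otherwise; on the
  right, dilation by p turns w into w^p.\<close>

lemma refinement_spectrum:
  fixes e :: "int \<Rightarrow> complex"
  assumes p: "p > 0" and q: "q > 0" and per: "\<And>k. e (k + int q) = e k"
    and ref: "\<And>k. e (k - int s) = (\<Sum>j<m. g j * (if int p dvd k - int j then e ((k - int j) div int p) else 0))"
    and w: "w ^ (p * q) = 1"
  shows "w ^ s * ((\<Sum>k<q. e (int k) * w ^ k) * (\<Sum>i<p. (w ^ q) ^ i))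
    = (\<Sum>j<m. g j * w ^ j) * (\<Sum>k<q. e (int k) * (w ^ p) ^ k)"
proof -
  let ?L = "p * q"
  \<comment> \<open>\<open>c\<close> is \<open>e\<close> spread out over the multiples of p, with
    zeros between them; its period is p q.\<close>
  define c where "c k = (if int p dvd k then e (k div int p) else 0)" for k
  have w0: "w \<noteq> 0" using w p q by (auto simp: power_0_left)
  have "w powi int ?L = 1" using w by (simp only: power_int_of_nat)
  then have wL: "w powi (k + int ?L) = w powi k" for k
    using w0 by (simp only: power_int_add mult_1_right simp_thms)
  have perL: "e (k + int ?L) = e k" for k
    using periodic_add_mult[of e q k p] per by simp
  have cper: "c (k + int ?L) = c k" for k
  proof -
    have "(k + int p * int q) div int p = k div int p + int q" using p by simp
    moreover have "int p dvd k + int p * int q \<longleftrightarrow> int p dvd k"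
      by (rule dvd_add_left_iff) simp
    ultimately show ?thesis using per by (simp add: c_def)
  qed
  \<comment> \<open>Translation by t becomes multiplication by w^t. Integer exponents are used
    because \<open>int k - int t\<close> may be negative.\<close>
  have tr: "(\<Sum>k<?L. f (int k - int t) * w powi (int k)) = w ^ t * (\<Sum>k<?L. f (int k) * w ^ k)"
    if "\<And>k. f (k + int ?L) = f k" for f t
  proof -
    have "(\<Sum>k<?L. f (int k - int t) * w powi (int k))
        = (\<Sum>k<?L. w ^ t * (f (int k - int t) * w powi (int k - int t)))"
      using w0 by (intro sum.cong refl) (simp add: power_int_diff)
    also have "\<dots> = w ^ t * (\<Sum>k<?L. f (int k) * w powi (int k))"
      using sum_lessThan_shift[of "\<lambda>k. f k * w powi k" ?L t] that wL
      by (simp flip: sum_distrib_left)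
    finally show ?thesis by simp
  qed
  have "w ^ s * (\<Sum>k<?L. e (int k) * w ^ k) = (\<Sum>k<?L. e (int k - int s) * w powi (int k))"
    by (rule tr[where f = e, OF perL, symmetric])
  also have "\<dots> = (\<Sum>k<?L. \<Sum>j<m. g j * (c (int k - int j) * w powi (int k)))"
    by (simp add: ref c_def sum_distrib_right mult.assoc)
  also have "\<dots> = (\<Sum>j<m. g j * (\<Sum>k<?L. c (int k - int j) * w powi (int k)))"
    by (subst sum.swap) (simp add: sum_distrib_left)
  also have "\<dots> = (\<Sum>j<m. g j * w ^ j) * (\<Sum>k<?L. c (int k) * w ^ k)"
    unfolding tr[where f = c, OF cper] by (simp add: sum_distrib_right mult.assoc)
  also have "(\<Sum>k<?L. c (int k) * w ^ k) = (\<Sum>k<q. \<Sum>i<p. c (int (k * p + i)) * w ^ (k * p + i))"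
    by (subst mult.commute[of p]) (rule sum_lessThan_mult)
  also have "\<dots> = (\<Sum>k<q. e (int k) * (w ^ p) ^ k)"
  proof (rule sum.cong[OF refl])
    fix k
    \<comment> \<open>Within a block of length p only the multiple of p survives.\<close>
    have "(\<Sum>i<p. c (int (k * p + i)) * w ^ (k * p + i))
        = (\<Sum>i<p. if i = 0 then c (int (k * p)) * w ^ (k * p) else 0)"
    proof (rule sum.cong[OF refl])
      fix i assume "i \<in> {..<p}"
      then show "c (int (k * p + i)) * w ^ (k * p + i)
        = (if i = 0 then c (int (k * p)) * w ^ (k * p) else 0)"
        using zdvd_not_zless[of "int i" "int p"] by (auto simp: c_def)
    qed
    also have "\<dots> = c (int (k * p)) * w ^ (k * p)" using p by simp
    also have "\<dots> = e (int k) * (w ^ p) ^ k"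
      using p by (simp add: c_def power_mult mult.commute flip: power_mult)
    finally show "(\<Sum>i<p. c (int (k * p + i)) * w ^ (k * p + i)) = e (int k) * (w ^ p) ^ k" .
  qed
  also have "(\<Sum>k<?L. e (int k) * w ^ k) = (\<Sum>i<p. \<Sum>k<q. e (int (i * q + k)) * w ^ (i * q + k))"
    by (rule sum_lessThan_mult)
  also have "\<dots> = (\<Sum>i<p. \<Sum>k<q. e (int k) * w ^ k * (w ^ q) ^ i)"
  proof (intro sum.cong refl)
    fix i k
    have "e (int (i * q + k)) = e (int k)"
      using periodic_add_mult[of e q "int k" i] per by (simp add: add.commute)
    then show "e (int (i * q + k)) * w ^ (i * q + k) = e (int k) * w ^ k * (w ^ q) ^ i"
      by (simp add: power_add power_mult mult.commute[of i q])
  qed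
  also have "\<dots> = (\<Sum>k<q. e (int k) * w ^ k) * (\<Sum>i<p. (w ^ q) ^ i)"
    by (subst sum.swap) (simp add: sum_product)
  finally show ?thesis .
qed

text \<open>Parseval's identity on the cyclic group of order q, applied to two translates:
  multiplying \<open>F\<close> by w^s corresponds to translating the sequence by s.\<close>

lemma sum_spectrum:
  fixes e :: "int \<Rightarrow> complex"
  assumes q: "q > 0" and per: "\<And>k. e (k + int q) = e k"
  defines "F \<equiv> \<lambda>w. \<Sum>k<q. e (int k) * w ^ k"
  shows "(\<Sum>w | w ^ q = 1. (F w * w ^ s) * cnj (F w * w ^ t))
    = of_nat q * (\<Sum>k<q. e (int k - int s) * cnj (e (int k - int t)))"
proof -
  let ?S = "{w::complex. w ^ q = 1}"
  have F: "F w * w ^ s = (\<Sum>k<q. e (int k - int s) * w ^ k)" if "w \<in> ?S" for w s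
  proof -
    have w0: "w \<noteq> 0" using that q by (auto simp: power_0_left)
    have wL: "w powi (k + int q) = w powi k" for k
      using that w0 by (simp add: power_int_add)
    have "(\<Sum>k<q. e (int k - int s) * w ^ k)
        = (\<Sum>k<q. w ^ s * (e (int k - int s) * w powi (int k - int s)))"
      using w0 by (intro sum.cong refl) (simp add: power_int_diff)
    also have "\<dots> = w ^ s * (\<Sum>k<q. e (int k) * w powi (int k))"
      using sum_lessThan_shift[of "\<lambda>k. e k * w powi k" q s] per wL
      by (simp flip: sum_distrib_left)
    finally show ?thesis by (simp add: F_def mult.commute)
  qed
  have "(\<Sum>w\<in>?S. (F w * w ^ s) * cnj (F w * w ^ t))
      = (\<Sum>w\<in>?S. \<Sum>k<q. \<Sum>l<q. e (int k - int s) * cnj (e (int l - int t)) * (w ^ k * cnj w ^ l))"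
    by (intro sum.cong refl) (simp only: F cnj_sum sum_product complex_cnj_mult complex_cnj_power ac_simps)
  also have "\<dots> = (\<Sum>k<q. \<Sum>l<q. e (int k - int s) * cnj (e (int l - int t)) * (\<Sum>w\<in>?S. w ^ k * cnj w ^ l))"
    by (subst sum.swap, intro sum.cong refl, subst sum.swap) (simp add: sum_distrib_left)
  also have "\<dots> = (\<Sum>k<q. \<Sum>l<q. if k = l then e (int k - int s) * cnj (e (int l - int t)) * of_nat q else 0)"
    by (intro sum.cong refl) (simp add: sum_roots_unity_powers)
  also have "\<dots> = of_nat q * (\<Sum>k<q. e (int k - int s) * cnj (e (int k - int t)))"
    by (simp add: sum_distrib_left mult.commute)
  finally show ?thesis .
qed

text \<open>By \<open>orth\<close>, the monomials of degree below n are orthogonal on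
  \<open>E\<close> with weight |F|^2 and common squared norm \<open>C\<close>. A polynomial in this
  range that vanishes on \<open>E\<close> except at the single point z therefore has coefficients
  proportional to the conjugate powers of z.\<close>

lemma spectrum_roots_unity:
  fixes F :: "complex \<Rightarrow> complex"
  assumes fin: "finite E" and card: "card E \<le> n" and E: "1 \<in> E" "z \<in> E" and F: "F z \<noteq> 0"
    and orth: "\<And>s t. s < n \<Longrightarrow> t < n \<Longrightarrow>
      (\<Sum>w\<in>E. (F w * w ^ s) * cnj (F w * w ^ t)) = (if s = t then C else 0)"
  shows "z ^ n = 1"
proof (cases "z = 1")
  case False
  \<comment> \<open>The zeros are all points of \<open>E\<close> but z, so the degree is |E| - 1 <
    n.\<close>
  define Q where "Q = (\<Prod>w\<in>E - {z}. [:- w, 1:])"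
  have Q0: "poly Q w = 0 \<longleftrightarrow> w \<in> E - {z}" for w
    using fin by (auto simp: Q_def poly_prod)
  have "degree Q = card (E - {z})"
    unfolding Q_def by (subst degree_prod_eq_sum_degree) auto
  moreover have "card E > 0" using fin E card_gt_0_iff by blast
  ultimately have degQ: "degree Q < n" using card fin E by simp
  \<comment> \<open>Pair \<open>Q\<close> with the monomial of degree t: over degrees only s = t
    survives, over points only w = z.\<close>
  have co: "C * coeff Q t = F z * cnj (F z) * poly Q z * cnj z ^ t" if t: "t < n" for t
  proof -
    have "C * coeff Q t = (\<Sum>s<n. if s = t then C * coeff Q s else 0)" using t by simp
    also have "\<dots> = (\<Sum>s<n. coeff Q s * (\<Sum>w\<in>E. (F w * w ^ s) * cnj (F w * w ^ t)))"
      by (intro sum.cong refl, subst orth) (use t in auto)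
    also have "\<dots> = (\<Sum>w\<in>E. \<Sum>s<n. F w * cnj (F w * w ^ t) * (coeff Q s * w ^ s))"
      by (simp only: sum_distrib_left, subst sum.swap) (simp add: ac_simps)
    also have "\<dots> = (\<Sum>w\<in>E. F w * cnj (F w * w ^ t) * poly Q w)"
      by (simp add: poly_lessThan[OF degQ] sum_distrib_left)
    also have "\<dots> = (\<Sum>w\<in>E. if w = z then F w * cnj (F w * w ^ t) * poly Q w else 0)"
      by (intro sum.cong refl) (use Q0 in auto)
    also have "\<dots> = F z * cnj (F z * z ^ t) * poly Q z" using E fin by simp
    finally show ?thesis by (simp add: ac_simps)
  qed
  \<comment> \<open>Since z is not 1, the point 1 is a zero of \<open>Q\<close>; the geometric sum
    of powers of \<open>cnj z\<close> must then vanish.\<close>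
  have "0 = C * poly Q 1" using Q0[of 1] E False by simp
  also have "\<dots> = (\<Sum>t<n. F z * cnj (F z) * poly Q z * cnj z ^ t)"
    by (simp add: poly_lessThan[OF degQ] sum_distrib_left co)
  also have "\<dots> = F z * cnj (F z) * poly Q z * (\<Sum>t<n. cnj z ^ t)" by (simp add: sum_distrib_left)
  finally have "(\<Sum>t<n. cnj z ^ t) = 0" using F Q0[of z] by simp
  then have "cnj z ^ n = 1" using power_diff_1_eq[of "cnj z" n] by simp
  then show ?thesis by (metis complex_cnj_cnj complex_cnj_one complex_cnj_power)
qed simp

text \<open>The p-adic theorem in finite form: \<open>e\<close> will hold the values of phi on a
  grid, \<open>n\<close> counts the translates inside the supporting ball, and z is a frequency at
  which the transform does not vanish.\<close>

lemma orthogonal_refinable_spectrum: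
  fixes e :: "int \<Rightarrow> complex"
  assumes p: "p \<ge> 2" and q: "q > 0" and n: "n > 0" and per: "\<And>k. e (k + int q) = e k"
    and orth: "\<And>s t. s < n \<Longrightarrow> t < n \<Longrightarrow>
      (\<Sum>k<q. e (int k - int s) * cnj (e (int k - int t))) = (if s = t then C else 0)"
    and ref: "\<And>s. s < n \<Longrightarrow> \<exists>g. \<forall>k. e (k - int s) =
      (\<Sum>j<p * n. g j * (if int p dvd k - int j then e ((k - int j) div int p) else 0))"
  defines "F \<equiv> \<lambda>w. \<Sum>k<q. e (int k) * w ^ k"
  assumes one: "F 1 \<noteq> 0" and z: "z ^ q = 1" "F z \<noteq> 0"
  shows "z ^ n = 1"
proof -
  define E where "E = {w. w ^ q = 1 \<and> F w \<noteq> 0}"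
  have fin: "finite E" using finite_nth_roots[OF q, of 1] by (auto simp: E_def intro: finite_subset)
  define g where "g s = (SOME g. \<forall>k. e (k - int s) =
      (\<Sum>j<p * n. g j * (if int p dvd k - int j then e ((k - int j) div int p) else 0)))" for s
  have g: "e (k - int s) =
      (\<Sum>j<p * n. g s j * (if int p dvd k - int j then e ((k - int j) div int p) else 0))"
    if "s < n" for s k
    using someI_ex[OF ref[OF that]] unfolding g_def by blast
  define P where "P s = (\<Sum>j<p * n. monom (g s j) j)" for s
  have poly_P: "poly (P s) w = (\<Sum>j<p * n. g s j * w ^ j)" for s w
    by (simp add: P_def poly_sum poly_monom)
  have deg: "degree (P s) < p * n" for s
  proof -
    have "degree (P s) \<le> p * n - 1" unfolding P_def
      by (intro degree_sum_le) (auto intro: order_trans[OF degree_monom_le])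
    moreover have "p * n > 0" using p n by simp
    ultimately show ?thesis by linarith
  qed
  \<comment> \<open>\<open>H\<close> is p times \<open>F\<close> at the q-th roots of unity and 0 at
    the other roots of unity of order dividing p q, where the geometric sum vanishes.\<close>
  define H where "H w = F w * (\<Sum>i<p. (w ^ q) ^ i)" for w
  have rel: "w ^ s * H w = poly (P s) w * F (w ^ p)" if "s < n" "w ^ (p * q) = 1" for s w
    using refinement_spectrum[OF _ q per g that(2), of s] that(1) p
    by (simp add: H_def F_def poly_P)
  have wE: "w ^ (p * q) = 1" if "w ^ p \<in> E" for w
    using that by (simp add: E_def power_mult)
  have H0: "H w = 0" if "w ^ p \<in> E" "w \<notin> E" for w
  proof (cases "w ^ q = 1")
    case True then show ?thesis using that by (simp add: H_def E_def)
  next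
    case False
    have "(w ^ q) ^ p = 1" using wE[OF that(1)] by (simp add: power_mult mult.commute[of p])
    then show ?thesis using False power_diff_1_eq[of "w ^ q" p] by (simp add: H_def)
  qed
  have HE: "H w = of_nat p * F w" if "w ^ q = 1" for w using that by (simp add: H_def)
  have "card E \<le> n"
  proof (rule card_spectrum_le[where P = P, OF p fin _ _ deg n])
    show "0 \<notin> E" using q by (auto simp: E_def power_0_left)
    show "1 \<in> E" using one by (simp add: E_def)
    \<comment> \<open>Divide the relations for s and for 0 by \<open>F (w ^ p)\<close>, which is
      nonzero since w^p lies in \<open>E\<close>.\<close>
    show "poly (P s) w = w ^ s * poly (P 0) w" if "s < n" "w ^ p \<in> E" for s w
      using rel[OF that(1) wE[OF that(2)]] rel[OF n wE[OF that(2)]] that(2) by (auto simp: E_def)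
    show "poly (P 0) w = 0" if "w ^ p \<in> E" "w \<notin> E" for w
      using rel[OF n wE[OF that(1)]] H0[OF that] that(1) by (auto simp: E_def)
    show "poly (P 0) 1 \<noteq> 0" using rel[OF n, of 1] HE[of 1] one p by auto
    \<comment> \<open>On \<open>E\<close> the left side of \<open>rel\<close> with s = 0 is p times
      \<open>F w\<close>, hence nonzero, so the factor \<open>F (w ^ p)\<close> on the right cannot
      vanish.\<close>
    show "w ^ p \<in> E" if "w \<in> E" for w
    proof -
      have "(w ^ p) ^ q = (w ^ q) ^ p" by (simp add: mult.commute flip: power_mult)
      then have 1: "(w ^ p) ^ q = 1" "w ^ (p * q) = 1"
        using that by (simp_all add: E_def power_mult)
      with rel[OF n 1(2)] HE[of w] that p have "F (w ^ p) \<noteq> 0" by (auto simp: E_def)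
      with 1 show ?thesis by (simp add: E_def)
    qed
  qed
  \<comment> \<open>\<open>F\<close> vanishes at the q-th roots of unity outside \<open>E\<close>,
    so Parseval's identity turns orthogonality of translates into orthogonality of monomials on
    \<open>E\<close>.\<close>
  moreover have "(\<Sum>w\<in>E. (F w * w ^ s) * cnj (F w * w ^ t)) = (if s = t then of_nat q * C else 0)"
    if "s < n" "t < n" for s t
  proof -
    have "(\<Sum>w\<in>E. (F w * w ^ s) * cnj (F w * w ^ t))
        = (\<Sum>w | w ^ q = 1. (F w * w ^ s) * cnj (F w * w ^ t))"
      using finite_nth_roots[OF q, of 1] by (intro sum.mono_neutral_left) (auto simp: E_def)
    then show ?thesis using sum_spectrum[where e = e, OF q per, of s t] orth[OF that] by (simp add: F_def)
  qed
  ultimately show ?thesis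
    using spectrum_roots_unity[OF fin, of n z F "of_nat q * C"] one z by (auto simp: E_def)
qed

section \<open>The field of p-adic numbers and its additive character\<close>

locale padic =
  fixes p :: nat and nrm :: "'a::field_char_0 \<Rightarrow> real"
  assumes is_Qp: "is_Qp p nrm"
begin

section \<open>The ultrametric norm and its values on rationals\<close>

lemma prime_p: "prime p"
  and nrm_nonneg [simp]: "nrm x \<ge> 0"
  and nrm_eq_0_iff [simp]: "nrm x = 0 \<longleftrightarrow> x = 0"
  and nrm_mult: "nrm (x * y) = nrm x * nrm y"
  and nrm_add_le: "nrm (x + y) \<le> max (nrm x) (nrm y)"
  and nrm_of_rat: "nrm (of_rat q) = padic_abs_rat p q"
  using is_Qp unfolding is_Qp_def by (elim conjE; simp only:)+

lemma rat_dense: "r > 0 \<Longrightarrow> \<exists>q. nrm (x - of_rat q) < r"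
  using is_Qp unfolding is_Qp_def by (elim conjE) simp

lemma p_ge_2: "p \<ge> 2"
  using prime_p prime_ge_2_nat by blast

lemma p_gt_0 [simp]: "p > 0" and p_neq_0 [simp]: "p \<noteq> 0"
  using p_ge_2 by simp_all

lemma nrm_0 [simp]: "nrm 0 = 0"
  by simp

lemma nrm_1 [simp]: "nrm 1 = 1"
proof -
  have "nrm 1 * nrm 1 = nrm 1 * 1" using nrm_mult[of 1 1] by simp
  then show ?thesis by (simp only: mult_cancel_left) simp
qed

lemma nrm_minus [simp]: "nrm (- x) = nrm x"
proof -
  have "nrm (- 1) * nrm (- 1) = 1" using nrm_mult[of "- 1" "- 1"] by simp
  then have "nrm (- 1) = 1"
    using nrm_nonneg[of "- 1"] by (metis abs_of_nonneg power2_eq_square power2_eq_1_iff abs_minus_cancel abs_1)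
  then show ?thesis using nrm_mult[of "- 1" x] by simp
qed

lemma nrm_minus_commute: "nrm (x - y) = nrm (y - x)"
  using nrm_minus[of "x - y"] by simp

lemma nrm_add_leI: "nrm x \<le> r \<Longrightarrow> nrm y \<le> r \<Longrightarrow> nrm (x + y) \<le> r"
  using nrm_add_le[of x y] by simp

lemma nrm_diff_leI: "nrm x \<le> r \<Longrightarrow> nrm y \<le> r \<Longrightarrow> nrm (x - y) \<le> r"
  using nrm_add_leI[of x r "- y"] by simp

text \<open>In an ultrametric the two longest sides of a triangle are equal.\<close>

lemma nrm_eq_of_diff_less:
  assumes "nrm (x - y) < nrm x" shows "nrm y = nrm x"
  using nrm_add_le[of "x - y" y] nrm_add_le[of "- (x - y)" x] assms nrm_minus[of "x - y"]
  by (simp add: max_def split: if_splits)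

lemma nrm_divide: "nrm (x / y) = nrm x / nrm y"
proof (cases "y = 0")
  case False
  then show ?thesis using nrm_mult[of "x / y" y] by (simp add: field_simps)
qed simp

lemma nrm_power: "nrm (x ^ n) = nrm x ^ n"
  by (induction n) (simp_all add: nrm_mult)

lemma nrm_of_int:
  assumes "k \<noteq> 0" shows "nrm (of_int k) = inverse (real p ^ multiplicity (int p) k)"
  using nrm_of_rat[of "of_int k"] assms
  by (simp add: padic_abs_rat_def padic_val_rat_def quotient_of_int[unfolded of_int_def] power_int_minus)

lemma nrm_of_int_le_iff: "nrm (of_int k) \<le> inverse (real p ^ m) \<longleftrightarrow> int p ^ m dvd k"
proof (cases "k = 0")
  case False
  have "\<not> is_unit (int p)" using p_ge_2 by simp
  then show ?thesis
    using False p_ge_2 power_dvd_iff_le_multiplicity[OF False, of "int p" m]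
    by (simp add: nrm_of_int)
qed simp

lemma nrm_of_int_le_1: "nrm (of_int k) \<le> 1"
  using nrm_of_int_le_iff[of k 0] by simp

lemma nrm_of_nat_le_1: "nrm (of_nat k) \<le> 1"
  using nrm_of_int_le_1[of "int k"] by simp

lemma nrm_p [simp]: "nrm (of_nat p) = inverse (real p)"
proof -
  have "multiplicity (int p) (int p) = 1" using p_ge_2 by (simp add: multiplicity_self)
  then show ?thesis using nrm_of_int[of "int p"] by simp
qed

lemma nrm_p_power [simp]: "nrm (of_nat p ^ n) = inverse (real p ^ n)"
  by (simp add: nrm_power power_inverse)

lemma nrm_p_powi [simp]: "nrm (of_nat p powi g) = real p powi (- g)"
proof (cases "g \<ge> 0")
  case True
  then show ?thesis by (simp add: power_int_def power_inverse)
next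
  case False
  then have "of_nat p powi g = 1 / (of_nat p ^ nat (- g) :: 'a)"
    by (simp add: power_int_def field_simps)
  then show ?thesis using False by (simp add: nrm_divide power_int_def inverse_eq_divide)
qed

lemma nrm_grid_le_iff:
  "nrm (of_int k / of_nat p ^ n) \<le> inverse (real p ^ m) \<longleftrightarrow> int p ^ (n + m) dvd k"
  using nrm_of_int_le_iff[of k "n + m"] by (simp add: nrm_divide field_simps power_add)

section \<open>Finite grids representing quotients of balls\<close>

text \<open>A nearby rational a / b of norm at most 1 has b prime to p, so b can be inverted modulo
  p^m and the quotient replaced by an integer residue.\<close>

lemma integer_approx:
  assumes "nrm x \<le> 1" shows "\<exists>k<p ^ m. nrm (x - of_nat k) \<le> inverse (real p ^ m)"
proof -
  obtain q where q: "nrm (x - of_rat q) < inverse (real p ^ m)"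
    using rat_dense[of "inverse (real p ^ m)" x] by auto
  have le1: "inverse (real p ^ m) \<le> 1" using p_ge_2 by (simp add: field_simps)
  obtain a b where ab: "quotient_of q = (a, b)" by fastforce
  have b: "b > 0" "coprime a b" "q = of_int a / of_int b"
    using quotient_of_denom_pos[OF ab] quotient_of_coprime[OF ab] quotient_of_div[OF ab] by auto
  have qe: "(of_rat q :: 'a) * of_int b = of_int a"
    using b by (simp add: of_rat_divide)
  have "nrm (of_rat q) \<le> 1"
    using nrm_diff_leI[of x 1 "x - of_rat q"] assms q le1 by simp
  then have ale: "nrm (of_int a) \<le> nrm (of_int b)"
    using arg_cong[OF qe, of nrm] mult_left_le[of "nrm (of_rat q)" "nrm (of_int b)"]
    by (simp add: nrm_mult mult.commute)
  \<comment> \<open>If p divided b, then |a| \<le> |b| < 1 would make p divide a as well, against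
    lowest terms.\<close>
  have nd: "\<not> int p dvd b"
  proof
    assume "int p dvd b"
    then have "nrm (of_int b) \<le> inverse (real p ^ 1)" using nrm_of_int_le_iff[of b 1] by simp
    with ale have "int p dvd a" using nrm_of_int_le_iff[of a 1] by simp
    with \<open>int p dvd b\<close> b(2) have "is_unit (int p)" by (meson coprime_common_divisor)
    then show False using p_ge_2 by simp
  qed
  have "prime (int p)" using prime_p by simp
  then have "coprime (int p ^ m) b" using nd prime_imp_coprime[of "int p" b] by simp
  then obtain u v where uv: "u * (int p ^ m) + v * b = 1"
    using bezout_int[of "int p ^ m" b] by auto
  \<comment> \<open>\<open>v\<close> inverts b modulo p^m, so v a is the residue of a / b.\<close>
  define k where "k = nat ((v * a) mod int p ^ m)"
  have k: "int k = (v * a) mod int p ^ m" using p_gt_0 by (simp add: k_def del: p_gt_0)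
  have dv: "int p ^ m dvd a - b * int k"
  proof -
    have "int p ^ m dvd v * a - int k" unfolding k by (simp add: dvd_minus_mod)
    then have "int p ^ m dvd b * (v * a - int k) + u * (int p ^ m) * a" by simp
    also have "b * (v * a - int k) + u * (int p ^ m) * a = (u * (int p ^ m) + v * b) * a - b * int k"
      by (simp add: algebra_simps)
    finally show ?thesis using uv by simp
  qed
  have "nrm (of_int b) = 1"
    using b(1) nd by (simp add: nrm_of_int not_dvd_imp_multiplicity_0)
  moreover have "(of_rat q - of_nat k) * of_int b = (of_int (a - b * int k) :: 'a)"
    using qe by (simp add: algebra_simps)
  ultimately have "nrm (of_rat q - of_nat k) = nrm (of_int (a - b * int k))"
    by (metis mult.right_neutral nrm_mult)
  with dv have "nrm (of_rat q - of_nat k) \<le> inverse (real p ^ m)"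
    using nrm_of_int_le_iff by metis
  with q have "nrm (x - of_nat k) \<le> inverse (real p ^ m)"
    using nrm_add_leI[of "x - of_rat q" "inverse (real p ^ m)" "of_rat q - of_nat k"] by simp
  moreover have "k < p ^ m"
    using k p_gt_0 by (metis of_nat_less_iff of_nat_power pos_mod_bound of_nat_0_less_iff zero_less_power)
  ultimately show ?thesis by blast
qed

text \<open>Multiplication by p^n reduces this to the unit ball. Together with uniqueness it
  identifies the balls of radius p^-m inside the ball of radius p^n with the integers modulo p^(n +
  m), the cyclic group on which integrals become finite sums.\<close>

lemma grid_approx:
  assumes "nrm x \<le> real p ^ n"
  shows "\<exists>k<p ^ (n + m). nrm (x - of_nat k / of_nat p ^ n) \<le> inverse (real p ^ m)"
proof -
  have "nrm (x * of_nat p ^ n) \<le> 1" using assms by (simp add: nrm_mult field_simps)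
  then obtain k where k: "k < p ^ (n + m)" "nrm (x * of_nat p ^ n - of_nat k) \<le> inverse (real p ^ (n + m))"
    using integer_approx by blast
  have "x - of_nat k / of_nat p ^ n = (x * of_nat p ^ n - of_nat k) / of_nat p ^ n"
    by (simp add: field_simps)
  then have "nrm (x - of_nat k / of_nat p ^ n) = nrm (x * of_nat p ^ n - of_nat k) * real p ^ n"
    by (simp only: nrm_divide nrm_p_power) (simp add: field_simps)
  also have "\<dots> \<le> inverse (real p ^ (n + m)) * real p ^ n"
    using k(2) by (intro mult_right_mono) auto
  also have "\<dots> = inverse (real p ^ m)" by (simp add: power_add)
  finally show ?thesis using k(1) by blast
qed

lemma grid_unique:
  assumes "k < p ^ (n + m)" "l < p ^ (n + m)"
    and "nrm (x - of_nat k / of_nat p ^ n) \<le> inverse (real p ^ m)"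
    and "nrm (x - of_nat l / of_nat p ^ n) \<le> inverse (real p ^ m)"
  shows "k = l"
proof -
  have "nrm (of_int (int k - int l) / of_nat p ^ n) \<le> inverse (real p ^ m)"
    using nrm_diff_leI[OF assms(4,3)] by (simp add: diff_divide_distrib)
  then have dv: "int p ^ (n + m) dvd int k - int l" by (simp only: nrm_grid_le_iff)
  have kl: "int k < int p ^ (n + m)" "int l < int p ^ (n + m)"
    using assms(1,2) by (metis of_nat_less_iff of_nat_power)+
  show ?thesis
    using mod_eq_dvd_iff[of "int k" "int p ^ (n + m)" "int l"] dv kl by (simp del: of_nat_power)
qed

text \<open>Both fractions are put on the grid of denominator p^(m + n). The type of the conclusion
  is separate from the p-adic field because \<open>fracp\<close> takes rational values.\<close>

lemma fraction_unique:
  assumes "k < p ^ m" "l < p ^ n"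
    and "nrm (x - of_nat k / of_nat p ^ m) \<le> 1" "nrm (x - of_nat l / of_nat p ^ n) \<le> 1"
  shows "(of_nat k / of_nat p ^ m :: 'b::field_char_0) = of_nat l / of_nat p ^ n"
proof -
  have "k * p ^ n = l * p ^ m"
  proof (rule grid_unique[where n = "m + n" and m = 0 and x = x])
    show "k * p ^ n < p ^ (m + n + 0)" "l * p ^ m < p ^ (m + n + 0)"
      using assms(1,2) by (simp_all add: power_add mult.commute)
    show "nrm (x - of_nat (k * p ^ n) / of_nat p ^ (m + n)) \<le> inverse (real p ^ 0)"
      "nrm (x - of_nat (l * p ^ m) / of_nat p ^ (m + n)) \<le> inverse (real p ^ 0)"
      using assms(3,4) by (simp_all add: power_add)
  qed
  then have "(of_nat k * of_nat p ^ n :: 'b) = of_nat l * of_nat p ^ m"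
    by (metis of_nat_mult of_nat_power)
  then show ?thesis by (simp add: field_simps)
qed

section \<open>Digit expansions and the fractional part\<close>

lemma digit_sum_less:
  assumes "\<And>j. d j < p" shows "(\<Sum>j<n. d j * p ^ j) < p ^ n"
proof (induction n)
  case (Suc n)
  have "(d n + 1) * p ^ n \<le> p * p ^ n" using assms[of n] by (intro mult_right_mono) auto
  then show ?case using Suc by simp
qed simp

text \<open>This is the predicate under the definite description in \<open>fracp\<close>, named in
  order to prove existence and uniqueness of the value described.\<close>

definition digit_expansion :: "'a \<Rightarrow> rat \<Rightarrow> bool" where
  "digit_expansion x r \<longleftrightarrow> (\<exists>(g::int) (d::nat \<Rightarrow> nat). (\<forall>j. d j < p) \<and> d 0 \<noteq> 0
     \<and> (\<lambda>n. nrm (of_nat p powi g * (\<Sum>j<n. of_nat (d j) * of_nat p ^ j) - x)) \<longlonglongrightarrow> 0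
     \<and> r = of_nat p powi g * (\<Sum>j<nat (- g). of_nat (d j) * of_nat p ^ j))"

lemma powi_mult_digit_sum:
  "(of_nat p powi g :: 'b::field_char_0) * of_nat (\<Sum>j<nat (- g). d j * p ^ j)
    = of_nat (\<Sum>j<nat (- g). d j * p ^ j) / of_nat p ^ nat (- g)"
  by (cases "g \<ge> 0") (auto simp: power_int_def field_simps)

text \<open>The digits at negative powers of p add up to k / p^m, and the later partial sums differ
  from it by elements of the unit ball, a property that passes to the limit x.\<close>

lemma digit_expansion_imp_fraction:
  assumes "digit_expansion x r"
  shows "\<exists>k m. k < p ^ m \<and> r = of_nat k / of_nat p ^ m \<and> nrm (x - of_nat k / of_nat p ^ m) \<le> 1"
proof -
  obtain g d where d: "\<And>j. d j < p"
    and lim: "(\<lambda>n. nrm (of_nat p powi g * (\<Sum>j<n. of_nat (d j) * of_nat p ^ j) - x)) \<longlonglongrightarrow> 0"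
    and r: "r = of_nat p powi g * (\<Sum>j<nat (- g). of_nat (d j) * of_nat p ^ j)"
    using assms unfolding digit_expansion_def by blast
  \<comment> \<open>For nonnegative g this is 0, so the sum of digits is empty and k = 0.\<close>
  define m where "m = nat (- g)"
  define k where "k = (\<Sum>j<m. d j * p ^ j)"
  define y where "y n = of_nat p powi g * (\<Sum>j<n. of_nat (d j) * of_nat p ^ j :: 'a)" for n
  note scale = powi_mult_digit_sum[of g d, folded m_def, folded k_def]
  have yk: "nrm (y n - of_nat k / of_nat p ^ m) \<le> 1" if "n \<ge> m" for n
  proof -
    have "{..<n} = {..<m} \<union> {m..<n}" using that by auto
    then have "(\<Sum>j<n. d j * p ^ j) = k + (\<Sum>j=m..<n. d j * p ^ j)"
      by (simp add: k_def sum.union_disjoint ivl_disj_int)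
    also have "(\<Sum>j=m..<n. d j * p ^ j) = p ^ m * (\<Sum>j=m..<n. d j * p ^ (j - m))"
      by (simp add: sum_distrib_left ac_simps flip: power_add)
    finally have "y n = of_nat p powi g * of_nat (k + p ^ m * (\<Sum>j=m..<n. d j * p ^ (j - m)))"
      unfolding y_def by (simp flip: of_nat_power of_nat_mult of_nat_sum)
    then have "y n - of_nat k / of_nat p ^ m
        = of_nat p powi g * of_nat p ^ m * of_nat (\<Sum>j=m..<n. d j * p ^ (j - m))"
      by (simp add: distrib_left mult.assoc del: of_nat_sum flip: scale)
    then have "nrm (y n - of_nat k / of_nat p ^ m)
        = real p powi (- g) * inverse (real p ^ m) * nrm (of_nat (\<Sum>j=m..<n. d j * p ^ (j - m)))"
      by (simp add: nrm_mult del: of_nat_sum)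
    also have "\<dots> \<le> 1 * 1"
    proof (intro mult_mono nrm_of_nat_le_1)
      show "real p powi (- g) * inverse (real p ^ m) \<le> 1"
      proof (cases "g \<ge> 0")
        case True
        have "real p powi (- g) = inverse (real p ^ nat g)"
          using True by (simp add: power_int_minus) (simp add: power_int_def)
        moreover have "1 \<le> real p ^ nat g" using p_ge_2 by (intro one_le_power) simp
        ultimately show ?thesis using True by (simp add: m_def inverse_le_1_iff)
      qed (simp add: m_def power_int_def)
    qed auto
    finally show ?thesis by simp
  qed
  \<comment> \<open>A single partial sum, beyond index m and within distance 1 of x,
    suffices.\<close>
  have "\<forall>\<^sub>F n in sequentially. nrm (y n - x) < 1"
    using order_tendstoD(2)[OF lim, of 1] by (simp add: y_def)
  then obtain n0 where n0: "\<And>n. n \<ge> n0 \<Longrightarrow> nrm (y n - x) < 1"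
    unfolding eventually_sequentially by blast
  have "nrm (x - of_nat k / of_nat p ^ m) \<le> 1"
    using nrm_diff_leI[OF yk[of "max m n0"], of "y (max m n0) - x"] n0[of "max m n0"] by simp
  moreover have "r = of_nat k / of_nat p ^ m"
    using r scale[where 'b = rat] by (simp add: k_def m_def)
  moreover have "k < p ^ m" unfolding k_def using d by (rule digit_sum_less)
  ultimately show ?thesis by blast
qed

text \<open>A rational closer to x than |x| has the same norm as x, by the ultrametric inequality,
  and nonzero rationals have powers of p as norms.\<close>

lemma nrm_value:
  assumes "x \<noteq> 0" shows "\<exists>v. nrm x = real p powi v"
proof -
  obtain q where "nrm (x - of_rat q) < nrm x" using rat_dense[of "nrm x" x] assms
    by (metis nrm_eq_0_iff nrm_nonneg order_le_less)
  then have "nrm x = padic_abs_rat p q" using nrm_eq_of_diff_less nrm_of_rat by metis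
  moreover have "q \<noteq> 0" using assms calculation nrm_eq_0_iff by (auto simp: padic_abs_rat_def)
  ultimately show ?thesis by (auto simp: padic_abs_rat_def)
qed

text \<open>After scaling to a unit y, the residues \<open>A n\<close> of y modulo p^n are
  compatible, and their successive differences give the digits.\<close>

lemma digit_expansion_exists:
  assumes "x \<noteq> 0" shows "\<exists>r. digit_expansion x r"
proof -
  obtain v where v: "nrm x = real p powi v" using nrm_value[OF assms] by blast
  define y where "y = x * of_nat p powi v"
  have xy: "x = of_nat p powi (- v) * y" by (simp add: y_def power_int_minus)
  have y1: "nrm y = 1" by (simp add: y_def nrm_mult v power_int_minus)
  define A where "A n = (SOME k. k < p ^ n \<and> nrm (y - of_nat k) \<le> inverse (real p ^ n))" for n
  have A: "A n < p ^ n" "nrm (y - of_nat (A n)) \<le> inverse (real p ^ n)" for n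
    using someI_ex[OF integer_approx[of y n, unfolded Bex_def]] y1 by (auto simp: A_def)
  have A_mod: "A (Suc n) mod p ^ n = A n" for n
  proof -
    have "inverse (real p ^ Suc n) \<le> inverse (real p ^ n)"
      using p_ge_2 by (intro le_imp_inverse_le) auto
    then have "nrm (y - of_nat (A (Suc n))) \<le> inverse (real p ^ n)" using A(2)[of "Suc n"] by linarith
    from nrm_diff_leI[OF A(2)[of n] this]
    have "nrm (of_int (int (A (Suc n)) - int (A n))) \<le> inverse (real p ^ n)" by simp
    then have "int p ^ n dvd int (A (Suc n)) - int (A n)" by (simp only: nrm_of_int_le_iff)
    then have "int (A (Suc n)) mod int (p ^ n) = int (A n) mod int (p ^ n)"
      by (simp add: mod_eq_dvd_iff)
    then have "A (Suc n) mod p ^ n = A n mod p ^ n" by (simp only: flip: zmod_int)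
    then show ?thesis using A(1) by simp
  qed
  define d where "d j = A (Suc j) div p ^ j" for j
  have sum: "A n = (\<Sum>j<n. d j * p ^ j)" for n
  proof (induction n)
    case 0
    then show ?case using A(1)[of 0] by simp
  next
    case (Suc n)
    have "A (Suc n) = A (Suc n) div p ^ n * p ^ n + A n" using A_mod[of n] div_mult_mod_eq by metis
    then show ?case using Suc by (simp add: d_def)
  qed
  have "d j < p" for j
    using A(1)[of "Suc j"] by (simp add: d_def less_mult_imp_div_less)
  \<comment> \<open>A zero first digit would put the unit y within 1 / p of 0.\<close>
  moreover have "d 0 \<noteq> 0"
  proof
    assume "d 0 = 0"
    then have "1 \<le> inverse (real p)" using A(2)[of 1] y1 by (simp add: d_def)
    then show False using p_ge_2 by (simp add: field_simps)
  qed
  moreover have "(\<lambda>n. nrm (of_nat p powi (- v) * (\<Sum>j<n. of_nat (d j) * of_nat p ^ j) - x)) \<longlonglongrightarrow> 0"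
  proof (rule tendsto_sandwich[where f = "\<lambda>_. 0" and h = "\<lambda>n. real p powi v * inverse (real p) ^ n"])
    have eq: "nrm (of_nat p powi (- v) * (\<Sum>j<n. of_nat (d j) * of_nat p ^ j) - x)
        = real p powi v * nrm (y - of_nat (A n))" for n
    proof -
      have "of_nat p powi (- v) * (\<Sum>j<n. of_nat (d j) * of_nat p ^ j) - x
          = of_nat p powi (- v) * (of_nat (A n) - y)"
        by (simp add: sum xy right_diff_distrib)
      then have "nrm (of_nat p powi (- v) * (\<Sum>j<n. of_nat (d j) * of_nat p ^ j) - x)
          = real p powi v * nrm (of_nat (A n) - y)"
        by (simp only: nrm_mult nrm_p_powi minus_minus)
      then show ?thesis by (simp only: nrm_minus_commute[of y])
    qed
    show "\<forall>\<^sub>F n in sequentially. nrm (of_nat p powi (- v) * (\<Sum>j<n. of_nat (d j) * of_nat p ^ j) - x)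
        \<le> real p powi v * inverse (real p) ^ n"
      unfolding eq using A(2) by (intro always_eventually allI mult_left_mono) (auto simp: power_inverse)
    show "(\<lambda>n. real p powi v * inverse (real p) ^ n) \<longlonglongrightarrow> 0"
      using p_ge_2 by (intro tendsto_mult_right_zero LIMSEQ_power_zero) (auto simp: field_simps)
  qed (auto intro: always_eventually)
  ultimately show ?thesis unfolding digit_expansion_def by blast
qed

text \<open>Every digit expansion produces an approximating fraction, and such fractions are unique,
  so the description is determined. From here on fractional parts come from arbitrary approximations
  k / p^m modulo the unit ball, and digits no longer appear.\<close>

lemma fracp_eq:
  assumes "k < p ^ m" "nrm (x - of_nat k / of_nat p ^ m) \<le> 1"
  shows "fracp p nrm x = of_nat k / of_nat p ^ m"
proof (cases "x = 0")
  case True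
  then show ?thesis using fraction_unique[of 0 0 k m x, where 'b = rat] assms by (simp add: fracp_def)
next
  case False
  have eq: "r = of_nat k / of_nat p ^ m" if "digit_expansion x r" for r
    using digit_expansion_imp_fraction[OF that] fraction_unique[OF _ assms(1) _ assms(2), where 'b = rat]
    by metis
  have "(THE r. digit_expansion x r) = of_nat k / of_nat p ^ m"
    using digit_expansion_exists[OF False] eq by (metis the_equality)
  then show ?thesis using False by (simp add: fracp_def digit_expansion_def)
qed

lemma fraction_exists: "\<exists>k m. k < p ^ m \<and> nrm (x - of_nat k / of_nat p ^ m) \<le> 1"
proof -
  obtain n where "nrm x < real p ^ n"
    using real_arch_pow[of "real p" "nrm x"] p_ge_2 by auto
  then show ?thesis using grid_approx[of x n 0] by auto
qed

lemma Ip_iff: "a \<in> Ip p nrm \<longleftrightarrow> (\<exists>k m. k < p ^ m \<and> a = of_nat k / of_nat p ^ m)"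
proof
  assume a: "a \<in> Ip p nrm"
  obtain k m where "k < p ^ m" "nrm (a - of_nat k / of_nat p ^ m) \<le> 1"
    using fraction_exists by blast
  then show "\<exists>k m. k < p ^ m \<and> a = of_nat k / of_nat p ^ m"
    using a fracp_eq[of k m a] by (auto simp: Ip_def of_rat_divide of_rat_power)
next
  assume "\<exists>k m. k < p ^ m \<and> a = of_nat k / of_nat p ^ m"
  then show "a \<in> Ip p nrm"
    using fracp_eq[where x = a] by (auto simp: Ip_def of_rat_divide of_rat_power)
qed

lemma Ip_ball:
  assumes "a \<in> Ip p nrm" "nrm a \<le> real p ^ n"
  shows "\<exists>k<p ^ n. a = of_nat k / of_nat p ^ n"
proof -
  obtain k where k: "k < p ^ n" "nrm (a - of_nat k / of_nat p ^ n) \<le> 1"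
    using grid_approx[OF assms(2), of 0] by auto
  then have "fracp p nrm a = of_nat k / of_nat p ^ n" by (rule fracp_eq)
  then show ?thesis using k(1) assms(1) by (auto simp: Ip_def of_rat_divide of_rat_power)
qed

section \<open>The additive character\<close>

text \<open>The numerator may be negative or unreduced: reduction modulo p^m changes the fraction by
  an integer t, which has norm at most 1 and multiplies the value by cis(2 pi t) = 1.\<close>

lemma chi_eq:
  assumes "nrm (x - of_int k / of_nat p ^ m) \<le> 1"
  shows "chi p nrm x = cis (2 * pi * real_of_int k / real p ^ m)"
proof -
  define l where "l = nat (k mod int p ^ m)"
  define t where "t = k div int p ^ m"
  have l: "int l = k mod int p ^ m" by (simp add: l_def)
  then have k: "k = int l + int p ^ m * t" by (simp add: t_def)
  have lp: "l < p ^ m"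
    using l by (metis of_nat_less_iff of_nat_power pos_mod_bound of_nat_0_less_iff zero_less_power p_gt_0)
  have "of_int k / of_nat p ^ m = (of_nat l / of_nat p ^ m + of_int t :: 'a)"
    by (simp add: k field_simps)
  then have "nrm (x - of_nat l / of_nat p ^ m) \<le> 1"
    using nrm_add_leI[OF assms nrm_of_int_le_1[of t]] by (simp add: algebra_simps)
  then have "fracp p nrm x = of_nat l / of_nat p ^ m" by (rule fracp_eq[OF lp])
  then have "chi p nrm x = cis (2 * pi * (real l / real p ^ m))"
    by (simp add: chi_def of_rat_divide of_rat_power)
  also have "\<dots> = cis (2 * pi * (real l / real p ^ m)) * cis (2 * pi * real_of_int t)" by simp
  also have "\<dots> = cis (2 * pi * real_of_int k / real p ^ m)"
    unfolding cis_mult by (rule arg_cong[of _ _ cis]) (simp add: k field_simps)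
  finally show ?thesis .
qed

lemma chi_add: "chi p nrm (x + y) = chi p nrm x * chi p nrm y"
proof -
  obtain k m where k: "nrm (x - of_nat k / of_nat p ^ m) \<le> 1" using fraction_exists by blast
  obtain l n where l: "nrm (y - of_nat l / of_nat p ^ n) \<le> 1" using fraction_exists by blast
  have "of_nat k / of_nat p ^ m + of_nat l / of_nat p ^ n
      = (of_int (int (k * p ^ n + l * p ^ m)) / of_nat p ^ (m + n) :: 'a)"
    by (simp add: field_simps power_add)
  then have "nrm (x + y - of_int (int (k * p ^ n + l * p ^ m)) / of_nat p ^ (m + n)) \<le> 1"
    using nrm_add_leI[OF k l] by (simp add: algebra_simps)
  from chi_eq[OF this]
  have "chi p nrm (x + y) = cis (2 * pi * (k * p ^ n + l * p ^ m) / real p ^ (m + n))" by simp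
  also have "\<dots> = cis (2 * pi * k / real p ^ m) * cis (2 * pi * l / real p ^ n)"
    unfolding cis_mult by (rule arg_cong[of _ _ cis]) (simp add: field_simps power_add)
  also have "\<dots> = chi p nrm x * chi p nrm y"
    using chi_eq[of x "int k" m] chi_eq[of y "int l" n] k l by simp
  finally show ?thesis .
qed

text \<open>Among the fractions k / p^m in [0, 1) only k = 0 gives the value 1, because distinct k
  give distinct roots of unity.\<close>

lemma chi_eq_1_iff: "chi p nrm x = 1 \<longleftrightarrow> nrm x \<le> 1"
proof
  assume "nrm x \<le> 1"
  then show "chi p nrm x = 1" using chi_eq[of x 0 0] by simp
next
  assume 1: "chi p nrm x = 1"
  obtain k m where k: "k < p ^ m" "nrm (x - of_nat k / of_nat p ^ m) \<le> 1"
    using fraction_exists by blast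
  have "p ^ m > 0" by simp
  from Complex.bij_betw_roots_unity[OF this]
  have "inj_on (\<lambda>k. cis (2 * pi * real k / real (p ^ m))) {..<p ^ m}" by (rule bij_betw_imp_inj_on)
  moreover have "cis (2 * pi * real k / real (p ^ m)) = cis (2 * pi * real 0 / real (p ^ m))"
    using chi_eq[of x "int k" m] k(2) 1 by simp
  ultimately have "k = 0" by (rule inj_onD) (use k in auto)
  then show "nrm x \<le> 1" using k(2) by simp
qed

lemma chi_of_nat_mult: "chi p nrm (of_nat k * x) = chi p nrm x ^ k"
proof (induction k)
  case 0
  then show ?case using chi_eq_1_iff[of 0] by simp
next
  case (Suc k)
  have "of_nat (Suc k) * x = x + of_nat k * x" by (simp add: algebra_simps)
  then show ?case using Suc by (simp only: chi_add power_Suc)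
qed

end

section \<open>Haar measure and the refinement equation\<close>

context padic
begin

text \<open>The constancy radius p^-m is uniform in the point; natural exponents, here and for the
  support, make p^(n + m) the number of grid balls.\<close>

definition loc_const :: "nat \<Rightarrow> ('a \<Rightarrow> 'b) \<Rightarrow> bool" where
  "loc_const m f \<longleftrightarrow> (\<forall>x y. nrm (x - y) \<le> inverse (real p ^ m) \<longrightarrow> f x = f y)"

definition supp_ball :: "nat \<Rightarrow> ('a \<Rightarrow> 'b::zero) \<Rightarrow> bool" where
  "supp_ball n f \<longleftrightarrow> (\<forall>x. f x \<noteq> 0 \<longrightarrow> nrm x \<le> real p ^ n)"

lemma loc_constD: "loc_const m f \<Longrightarrow> nrm (x - y) \<le> inverse (real p ^ m) \<Longrightarrow> f x = f y"
  by (simp add: loc_const_def)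

lemma supp_ballD: "supp_ball n f \<Longrightarrow> f x \<noteq> 0 \<Longrightarrow> nrm x \<le> real p ^ n"
  by (simp add: supp_ball_def)

lemma real_p_power_mono: "n \<le> n' \<Longrightarrow> real p ^ n \<le> real p ^ n'"
  using p_ge_2 by (intro power_increasing) auto

lemma supp_ball_mono: "supp_ball n f \<Longrightarrow> n \<le> n' \<Longrightarrow> supp_ball n' f"
  using real_p_power_mono unfolding supp_ball_def by (meson order_trans)

lemma loc_const_translate: "loc_const m f \<Longrightarrow> loc_const m (\<lambda>x. f (x - a))"
  by (simp add: loc_const_def)

lemma supp_ball_translate:
  assumes "supp_ball n f" "nrm a \<le> real p ^ n'" "n \<le> n'"
  shows "supp_ball n' (\<lambda>x. f (x - a))"
proof -
  have "nrm x \<le> real p ^ n'" if "f (x - a) \<noteq> 0" for x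
    using nrm_add_leI[OF _ assms(2), of "x - a"] supp_ballD[OF supp_ball_mono[OF assms(1,3)] that]
    by simp
  then show ?thesis by (simp add: supp_ball_def)
qed

lemma nrm_bounded: "\<exists>n. nrm x \<le> real p ^ n \<and> n0 \<le> n"
proof -
  obtain n where n: "nrm x < real p ^ n"
    using real_arch_pow[of "real p" "nrm x"] p_ge_2 by auto
  then have "nrm x \<le> real p ^ max n n0" using real_p_power_mono[of n "max n n0"] by simp
  then show ?thesis by (intro exI[of _ "max n n0"]) simp
qed

lemma supp_ball_sum:
  assumes "finite A" "\<And>a. a \<in> A \<Longrightarrow> \<exists>n. supp_ball n (f a)"
  shows "\<exists>n. supp_ball n (\<lambda>x. \<Sum>a\<in>A. f a x :: 'b::comm_monoid_add)"
  using assms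
proof (induction rule: finite_induct)
  case (insert b A)
  obtain n where n1: "supp_ball n (f b)" using insert.prems by blast
  obtain k where n2: "supp_ball k (\<lambda>x. \<Sum>a\<in>A. f a x)" using insert.IH insert.prems by blast
  note n = n1 n2
  have "supp_ball (max n k) (\<lambda>x. f b x + (\<Sum>a\<in>A. f a x))"
    unfolding supp_ball_def
  proof (intro allI impI)
    fix x assume "f b x + (\<Sum>a\<in>A. f a x) \<noteq> 0"
    then have "f b x \<noteq> 0 \<or> (\<Sum>a\<in>A. f a x) \<noteq> 0" by auto
    then show "nrm x \<le> real p ^ max n k"
      using supp_ballD[OF supp_ball_mono[OF n(1), of "max n k"]]
        supp_ballD[OF supp_ball_mono[OF n(2), of "max n k"]] by auto
  qed
  then show ?case using insert by auto
qed (simp add: supp_ball_def)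

lemma DNM_supp_ball:
  assumes "f \<in> DNM p nrm N M" "N \<le> int n" shows "supp_ball n f"
proof -
  have "real p powi N \<le> real p powi int n"
    using p_ge_2 assms(2) by (intro power_int_increasing) auto
  then show ?thesis using assms(1) by (auto simp: supp_ball_def DNM_def pball_def intro: order_trans)
qed

text \<open>The natural multiples of p^m are periods and are dense in the ball of radius p^-m. So y
  can be moved by periods arbitrarily close to x, where local constancy gives equality of the
  values.\<close>

lemma DNM_loc_const:
  assumes f: "f \<in> DNM p nrm N M" and m: "M \<le> int m" shows "loc_const m f"
  unfolding loc_const_def
proof (intro allI impI)
  fix x y assume xy: "nrm (x - y) \<le> inverse (real p ^ m)"
  have step: "f (w + of_nat p powi M) = f w" for w
    using f by (simp add: DNM_def)
  have steps: "f (w + of_nat i * of_nat p powi M) = f w" for w i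
  proof (induction i)
    case (Suc i)
    have "w + of_nat (Suc i) * of_nat p powi M = (w + of_nat i * of_nat p powi M) + of_nat p powi M"
      by (simp add: algebra_simps)
    then show ?case using step Suc by metis
  qed simp
  have "of_nat p ^ m = of_nat p ^ nat (int m - M) * (of_nat p powi M :: 'a)"
    using m by (simp flip: power_int_of_nat power_int_add)
  then have period: "f (w + of_nat k * of_nat p ^ m) = f w" for w k
    using steps[of w "k * p ^ nat (int m - M)"] by (simp add: mult.assoc)
  obtain e where e: "e > 0" "\<And>w. nrm (w - x) < e \<Longrightarrow> f w = f x"
    using f unfolding DNM_def test_fun_def by blast
  obtain j where j: "inverse (real p) ^ j < e"
    using real_arch_pow_inv[OF e(1), of "inverse (real p)"] p_ge_2 by (auto simp: field_simps)
  \<comment> \<open>The difference is rescaled to the unit ball, where natural numbers k are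
    dense.\<close>
  define u where "u = (x - y) / of_nat p ^ m"
  have "nrm u \<le> 1" using xy by (simp add: u_def nrm_divide field_simps)
  then obtain k where k: "nrm (u - of_nat k) \<le> inverse (real p ^ j)"
    using integer_approx by blast
  have "y + of_nat k * of_nat p ^ m - x = - (of_nat p ^ m * (u - of_nat k))"
    by (simp add: u_def field_simps)
  then have "nrm (y + of_nat k * of_nat p ^ m - x) = inverse (real p ^ m) * nrm (u - of_nat k)"
    by (simp only: nrm_minus nrm_mult nrm_p_power)
  also have "\<dots> \<le> 1 * nrm (u - of_nat k)"
    using p_ge_2 by (intro mult_right_mono) (auto simp: inverse_le_1_iff)
  also have "\<dots> < e" using k j by (simp add: power_inverse)
  finally show "f x = f y" using e(2) period by metis
qed

lemma pball_neg: "pball p nrm (- int m) c = {x. nrm (x - c) \<le> inverse (real p ^ m)}"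
  by (simp add: pball_def power_int_minus)

lemma nrm_open_pball: "nrm_open nrm (pball p nrm g c)"
  unfolding nrm_open_def
proof (intro ballI)
  fix x assume "x \<in> pball p nrm g c"
  then have x: "nrm (x - c) \<le> real p powi g" by (simp add: pball_def)
  have "y \<in> pball p nrm g c" if "nrm (y - x) < real p powi g" for y
    using nrm_add_leI[OF _ x, of "y - x"] that by (simp add: pball_def)
  moreover have "real p powi g > 0" by simp
  ultimately show "\<exists>e>0. \<forall>y. nrm (y - x) < e \<longrightarrow> y \<in> pball p nrm g c" by blast
qed

end

locale padic_haar = padic p nrm for p and nrm :: "'a::field_char_0 \<Rightarrow> real" +
  fixes mu :: "'a measure"
  assumes is_haar: "is_haar p nrm mu"
begin

section \<open>Haar measure of balls and integrals as finite sums\<close>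

lemma pball_sets [measurable]: "pball p nrm g c \<in> sets mu"
  using is_haar nrm_open_pball by (auto simp: is_haar_def intro: sigma_sets.Basic)

lemma emeasure_pball_translate: "emeasure mu (pball p nrm g c) = emeasure mu (pball p nrm g 0)"
proof -
  have "pball p nrm g c = (\<lambda>x. c + x) ` pball p nrm g 0"
  proof (intro set_eqI iffI)
    fix x assume "x \<in> pball p nrm g c"
    then show "x \<in> (\<lambda>x. c + x) ` pball p nrm g 0"
      by (intro image_eqI[of _ _ "x - c"]) (auto simp: pball_def)
  qed (auto simp: pball_def)
  then show ?thesis using is_haar pball_sets[of g 0] by (simp add: is_haar_def)
qed

text \<open>The unit ball is the disjoint union of p^m translates of the ball of radius p^-m, all of
  the same measure.\<close>

lemma emeasure_pball: "emeasure mu (pball p nrm (- int m) c) = ennreal (inverse (real p ^ m))"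
proof -
  let ?B = "\<lambda>k. pball p nrm (- int m) (of_nat k)"
  have un: "pball p nrm 0 0 = (\<Union>k<p ^ m. ?B k)"
  proof (intro set_eqI iffI)
    fix x assume "x \<in> pball p nrm 0 0"
    then show "x \<in> (\<Union>k<p ^ m. ?B k)"
      using integer_approx[of x m] by (auto simp: pball_def[of _ _ 0] pball_neg)
  next
    fix x assume "x \<in> (\<Union>k<p ^ m. ?B k)"
    then obtain k where k: "nrm (x - of_nat k) \<le> inverse (real p ^ m)" by (auto simp: pball_neg)
    have "inverse (real p ^ m) \<le> 1" using p_ge_2 by (simp add: inverse_le_1_iff)
    then show "x \<in> pball p nrm 0 0"
      using nrm_add_leI[OF _ nrm_of_nat_le_1, of "x - of_nat k" k] k by (simp add: pball_def)
  qed
  have disj: "disjoint_family_on ?B {..<p ^ m}"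
    unfolding disjoint_family_on_def
  proof (intro ballI impI equals0I)
    fix k l x assume "k \<in> {..<p ^ m}" "l \<in> {..<p ^ m}" "k \<noteq> l" "x \<in> ?B k \<inter> ?B l"
    then show False using grid_unique[of k 0 m l x] by (auto simp: pball_neg)
  qed
  have "1 = (\<Sum>k<p ^ m. emeasure mu (?B k))"
  proof (subst sum_emeasure[OF _ disj])
    show "?B ` {..<p ^ m} \<subseteq> sets mu" by (auto intro: pball_sets)
    show "1 = emeasure mu (\<Union>k<p ^ m. ?B k)" using is_haar un by (simp add: is_haar_def)
  qed simp
  also have "\<dots> = of_nat (p ^ m) * emeasure mu (pball p nrm (- int m) 0)"
    by (simp add: emeasure_pball_translate[of _ "of_nat _"])
  finally have 1: "of_nat (p ^ m) * emeasure mu (pball p nrm (- int m) 0) = 1" ..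
  \<comment> \<open>Finiteness comes first, so that the equation can be solved in the reals.\<close>
  have "emeasure mu (pball p nrm (- int m) 0) \<noteq> top"
    using 1 p_ge_2 by (auto simp: ennreal_mult_top)
  then obtain r where r: "r \<ge> 0" "emeasure mu (pball p nrm (- int m) 0) = ennreal r"
    by (metis ennreal_cases)
  have "ennreal (real (p ^ m) * r) = 1"
    using 1 r by (simp add: ennreal_mult ennreal_of_nat_eq_real_of_nat)
  then have "real p ^ m * r = 1" using r by (simp add: ennreal_eq_1)
  then have "r = inverse (real p ^ m)" by (simp add: field_simps)
  then show ?thesis using r emeasure_pball_translate by metis
qed

text \<open>Such a function is a finite sum of indicators of grid balls times values. The codomain
  is general in order to cover both complex integrands and squared moduli.\<close>

lemma has_integral_loc_const:
  fixes f :: "'a \<Rightarrow> 'b::{banach, second_countable_topology}"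
  assumes "loc_const m f" "supp_ball n f"
  shows "has_bochner_integral mu f
    (\<Sum>k<p ^ (n + m). inverse (real p ^ m) *\<^sub>R f (of_nat k / of_nat p ^ n))"
proof -
  let ?x = "\<lambda>k. of_nat k / of_nat p ^ n :: 'a"
  let ?B = "\<lambda>k. pball p nrm (- int m) (?x k)"
  have eq: "f = (\<lambda>x. \<Sum>k<p ^ (n + m). indicator (?B k) x *\<^sub>R f (?x k))"
  proof
    fix x
    show "f x = (\<Sum>k<p ^ (n + m). indicator (?B k) x *\<^sub>R f (?x k))"
    proof (cases "nrm x \<le> real p ^ n")
      case True
      then obtain k where k: "k < p ^ (n + m)" "nrm (x - ?x k) \<le> inverse (real p ^ m)"
        using grid_approx by blast
      have "x \<in> ?B l \<longleftrightarrow> l = k" if "l < p ^ (n + m)" for l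
        using grid_unique[OF that k(1) _ k(2)] k(2) by (auto simp: pball_neg)
      then have "(\<Sum>l<p ^ (n + m). indicator (?B l) x *\<^sub>R f (?x l))
          = (\<Sum>l<p ^ (n + m). if l = k then f (?x k) else 0)"
        by (intro sum.cong refl) (simp add: indicator_def)
      then show ?thesis using k(1) loc_constD[OF assms(1) k(2)] by simp
    next
      case False
      then have fx: "f x = 0" using supp_ballD[OF assms(2), of x] by blast
      \<comment> \<open>If a grid ball contains x, local constancy makes f vanish at its centre
        too.\<close>
      have "indicator (?B l) x *\<^sub>R f (?x l) = 0" for l
        using loc_constD[OF assms(1), of x "?x l"] fx
        by (cases "x \<in> ?B l") (simp_all add: pball_neg)
      then show ?thesis by (simp only: fx sum.neutral_const)
    qed
  qed
  have "has_bochner_integral mu (\<lambda>x. indicator (?B k) x *\<^sub>R f (?x k))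
      (inverse (real p ^ m) *\<^sub>R f (?x k))" for k
    using has_bochner_integral_indicator[OF pball_sets, of "- int m" "?x k" "f (?x k)"]
    by (simp add: emeasure_pball measure_def)
  then show ?thesis by (subst eq) (rule has_bochner_integral_sum)
qed

lemma integrable_loc_const:
  fixes f :: "'a \<Rightarrow> 'b::{banach, second_countable_topology}"
  assumes "loc_const m f" "supp_ball n f" shows "integrable mu f"
  using has_integral_loc_const[OF assms] by (rule integrable.intros)

lemma integral_loc_const:
  fixes f :: "'a \<Rightarrow> 'b::{banach, second_countable_topology}"
  assumes "loc_const m f" "supp_ball n f"
  shows "integral\<^sup>L mu f = (\<Sum>k<p ^ (n + m). inverse (real p ^ m) *\<^sub>R f (of_nat k / of_nat p ^ n))"
  using has_integral_loc_const[OF assms] by (rule has_bochner_integral_integral_eq)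

lemma sqint_loc_const:
  assumes "loc_const m f" "supp_ball n f" shows "sqint mu f"
  unfolding sqint_def
proof
  show "f \<in> borel_measurable mu"
    using integrable_loc_const[OF assms] by (rule borel_measurable_integrable)
  show "integrable mu (\<lambda>x. (cmod (f x))\<^sup>2)"
    using assms by (intro integrable_loc_const[of m _ n]) (auto simp: loc_const_def supp_ball_def)
qed

text \<open>The ball of radius p^-m around x alone contributes p^-m |f x|^2 to the squared norm. The
  constant is independent of the support radius, which matters for approximants of varying
  support.\<close>

lemma cmod_le_l2norm:
  assumes "loc_const m f" "supp_ball n f"
  shows "cmod (f x) \<le> sqrt (real p ^ m) * l2norm mu f"
proof -
  let ?g = "\<lambda>x. (cmod (f x))\<^sup>2"
  have int: "integral\<^sup>L mu ?g
      = (\<Sum>k<p ^ (n + m). inverse (real p ^ m) *\<^sub>R ?g (of_nat k / of_nat p ^ n))"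
    using assms by (intro integral_loc_const) (auto simp: loc_const_def supp_ball_def)
  have "?g x \<le> real p ^ m * integral\<^sup>L mu ?g"
  proof (cases "f x = 0")
    case False
    then obtain k where k: "k < p ^ (n + m)" "nrm (x - of_nat k / of_nat p ^ n) \<le> inverse (real p ^ m)"
      using supp_ballD[OF assms(2)] grid_approx by blast
    have "inverse (real p ^ m) *\<^sub>R ?g (of_nat k / of_nat p ^ n) \<le> integral\<^sup>L mu ?g"
      unfolding int using k(1)
      by (intro member_le_sum[where f = "\<lambda>k. inverse (real p ^ m) *\<^sub>R ?g (of_nat k / of_nat p ^ n)"]) auto
    then show ?thesis using loc_constD[OF assms(1) k(2)] by (simp add: field_simps)
  next
    case True
    then show ?thesis by (simp add: integral_nonneg)
  qed
  then have "sqrt (?g x) \<le> sqrt (real p ^ m * integral\<^sup>L mu ?g)" by (rule real_sqrt_le_mono)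
  then show ?thesis by (simp add: l2norm_def real_sqrt_mult)
qed

text \<open>For |xi| at most p^m the function chi(xi x) is constant on balls of radius p^-m, so the
  integral is a grid sum: a polynomial evaluated at the root of unity chi(xi / p^n).\<close>

lemma fourier_loc_const:
  assumes "loc_const m f" "supp_ball n f" "nrm xi \<le> real p ^ m"
  shows "fourier p nrm mu f xi = inverse (real p ^ m) *
    (\<Sum>k<p ^ (n + m). f (of_nat k / of_nat p ^ n) * chi p nrm (xi / of_nat p ^ n) ^ k)"
proof -
  have lc: "loc_const m (\<lambda>x. chi p nrm (xi * x) * f x)"
    unfolding loc_const_def
  proof (intro allI impI)
    fix x y assume xy: "nrm (x - y) \<le> inverse (real p ^ m)"
    have "nrm (xi * (x - y)) \<le> real p ^ m * inverse (real p ^ m)"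
      unfolding nrm_mult using assms(3) xy by (intro mult_mono) auto
    then have "chi p nrm (xi * (x - y)) = 1" by (simp add: chi_eq_1_iff)
    moreover have "xi * x = xi * y + xi * (x - y)" by (simp add: algebra_simps)
    ultimately have "chi p nrm (xi * x) = chi p nrm (xi * y)" by (simp only: chi_add mult_1_right)
    then show "chi p nrm (xi * x) * f x = chi p nrm (xi * y) * f y"
      using loc_constD[OF assms(1) xy] by simp
  qed
  have "supp_ball n (\<lambda>x. chi p nrm (xi * x) * f x)"
    using assms(2) by (auto simp: supp_ball_def)
  from integral_loc_const[OF lc this]
  have "fourier p nrm mu f xi = (\<Sum>k<p ^ (n + m). inverse (real p ^ m) *\<^sub>R
      (chi p nrm (xi * (of_nat k / of_nat p ^ n)) * f (of_nat k / of_nat p ^ n)))"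
    by (simp add: fourier_def)
  also have "\<dots> = (\<Sum>k<p ^ (n + m). inverse (real p ^ m) *
      (f (of_nat k / of_nat p ^ n) * chi p nrm (xi / of_nat p ^ n) ^ k))"
  proof (intro sum.cong refl)
    fix k
    have "xi * (of_nat k / of_nat p ^ n) = of_nat k * (xi / of_nat p ^ n)" by simp
    then show "inverse (real p ^ m) *\<^sub>R
        (chi p nrm (xi * (of_nat k / of_nat p ^ n)) * f (of_nat k / of_nat p ^ n))
      = inverse (real p ^ m) * (f (of_nat k / of_nat p ^ n) * chi p nrm (xi / of_nat p ^ n) ^ k)"
      by (simp only: chi_of_nat_mult scaleR_conv_of_real mult.commute)
  qed
  finally show ?thesis by (simp add: sum_distrib_left)
qed

text \<open>The grid is governed by the support of \<open>g\<close> alone, so one and the same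
  finite sum serves a whole sequence in place of \<open>f\<close>.\<close>

lemma l2inner_loc_const:
  assumes "loc_const m f" "loc_const m g" "supp_ball n g"
  shows "l2inner mu f g = (\<Sum>k<p ^ (n + m). inverse (real p ^ m) *\<^sub>R
    (f (of_nat k / of_nat p ^ n) * cnj (g (of_nat k / of_nat p ^ n))))"
  unfolding l2inner_def
proof (rule integral_loc_const)
  show "loc_const m (\<lambda>x. f x * cnj (g x))" "supp_ball n (\<lambda>x. f x * cnj (g x))"
    using assms unfolding loc_const_def supp_ball_def by (metis, auto)
qed

text \<open>Since both sides are constant on small balls, L2 convergence is pointwise convergence, and by
  orthonormality the coefficients of the approximants converge as well.\<close>
lemma l2closure_cspan_translates:
  fixes phi :: "'a \<Rightarrow> complex"
  assumes phi: "loc_const m phi" "supp_ball n phi"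
    and orth: "\<And>a b. a \<in> Ip p nrm \<Longrightarrow> b \<in> Ip p nrm \<Longrightarrow>
      l2inner mu (\<lambda>x. phi (x - a)) (\<lambda>x. phi (x - b)) = (if a = b then 1 else 0)"
    and f: "f \<in> l2closure mu (cspan {(\<lambda>x. phi (x - a)) | a. a \<in> Ip p nrm})"
      "loc_const m f" "supp_ball l f" and n: "n \<le> l"
  shows "\<exists>g. \<forall>x. nrm x \<le> real p ^ l \<longrightarrow>
    f x = (\<Sum>j<p ^ l. g j * phi (x - of_nat j / of_nat p ^ l))"
proof -
  let ?t = "\<lambda>a x. phi (x - a)"
  obtain F where F: "\<And>i. F i \<in> cspan {?t a | a. a \<in> Ip p nrm}"
    and lim: "(\<lambda>i. l2norm mu (\<lambda>x. F i x - f x)) \<longlonglongrightarrow> 0"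
    using f(1) unfolding l2closure_def by blast
  \<comment> \<open>The span is described by sets of functions; selecting one translation parameter
    for each function allows the sum to be indexed by parameters.\<close>
  have "\<exists>A c. finite A \<and> A \<subseteq> Ip p nrm \<and> F i = (\<lambda>x. \<Sum>a\<in>A. c a * phi (x - a))" for i
  proof -
    obtain S c where S: "finite S" "S \<subseteq> {?t a | a. a \<in> Ip p nrm}" "F i = (\<lambda>x. \<Sum>g\<in>S. c g * g x)"
      using F[of i] unfolding cspan_def by blast
    have "S \<subseteq> ?t ` Ip p nrm" using S(2) by blast
    with S(1) obtain A where A: "A \<subseteq> Ip p nrm" "finite A" "S = ?t ` A" "inj_on ?t A"
      unfolding subset_image_inj using finite_imageD by metis
    have "F i = (\<lambda>x. \<Sum>a\<in>A. c (?t a) * phi (x - a))"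
      unfolding S(3) A(3) by (simp add: sum.reindex[OF A(4)])
    then show ?thesis using A by (intro exI[of _ A] exI[of _ "\<lambda>a. c (?t a)"]) simp
  qed
  then obtain A c where A: "\<And>i. finite (A i)" "\<And>i. A i \<subseteq> Ip p nrm"
    and Fi: "\<And>i. F i = (\<lambda>x. \<Sum>a\<in>A i. c i a * phi (x - a))"
    by metis
  \<comment> \<open>Extension by 0 gives coefficients for all parameters, comparable for different
    i.\<close>
  define d where "d i a = (if a \<in> A i then c i a else 0)" for i a
  have F_lc: "loc_const m (F i)" for i
    unfolding loc_const_def Fi
    using loc_constD[OF loc_const_translate[OF phi(1)]] by (intro allI impI sum.cong refl) (metis)
  have t_supp: "\<exists>k. supp_ball k (?t a)" for a
    using nrm_bounded[of a n] supp_ball_translate[OF phi(2)] by blast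
  have F_supp: "\<exists>k. supp_ball k (F i)" for i
  proof -
    have "\<exists>k. supp_ball k (\<lambda>x. c i a * phi (x - a))" for a
      using t_supp[of a] by (auto simp: supp_ball_def)
    then show ?thesis unfolding Fi by (intro supp_ball_sum A(1))
  qed
  have pointwise: "(\<lambda>i. F i x) \<longlonglongrightarrow> f x" for x
  proof (rule LIM_zero_cancel, rule Lim_null_comparison)
    show "\<forall>\<^sub>F i in sequentially. norm (F i x - f x)
        \<le> sqrt (real p ^ m) * l2norm mu (\<lambda>x. F i x - f x)"
    proof (intro always_eventually allI)
      fix i
      obtain k where k: "supp_ball k (F i)" using F_supp by blast
      have "supp_ball (max k l) (\<lambda>x. F i x - f x)"
        using supp_ball_mono[OF k max.cobounded1] supp_ball_mono[OF f(3) max.cobounded2]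
        unfolding supp_ball_def by (metis diff_0_right)
      moreover have "loc_const m (\<lambda>x. F i x - f x)"
        using F_lc[of i] f(2) unfolding loc_const_def by metis
      ultimately show "norm (F i x - f x) \<le> sqrt (real p ^ m) * l2norm mu (\<lambda>x. F i x - f x)"
        by (intro cmod_le_l2norm)
    qed
    show "(\<lambda>i. sqrt (real p ^ m) * l2norm mu (\<lambda>x. F i x - f x)) \<longlonglongrightarrow> 0"
      by (rule tendsto_mult_right_zero[OF lim])
  qed
  have coeff: "l2inner mu (F i) (?t b) = d i b" if b: "b \<in> Ip p nrm" for i b
  proof -
    obtain k where k: "supp_ball k (?t b)" using t_supp by blast
    have "integrable mu (\<lambda>x. c i a * (phi (x - a) * cnj (phi (x - b))))" for a
    proof (rule integrable_loc_const)
      show "loc_const m (\<lambda>x. c i a * (phi (x - a) * cnj (phi (x - b))))"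
        using loc_const_translate[OF phi(1)] unfolding loc_const_def by metis
      show "supp_ball k (\<lambda>x. c i a * (phi (x - a) * cnj (phi (x - b))))"
        using k by (auto simp: supp_ball_def)
    qed
    then have "l2inner mu (F i) (?t b) = (\<Sum>a\<in>A i. LINT x|mu. c i a * (phi (x - a) * cnj (phi (x - b))))"
      unfolding l2inner_def Fi sum_distrib_right mult.assoc by (intro Bochner_Integration.integral_sum)
    also have "\<dots> = (\<Sum>a\<in>A i. c i a * l2inner mu (?t a) (?t b))"
      by (simp add: l2inner_def)
    also have "\<dots> = (\<Sum>a\<in>A i. if a = b then c i a else 0)"
      using A(2)[of i] b by (intro sum.cong refl) (subst orth; auto)
    also have "\<dots> = d i b" using A(1) by (simp add: d_def)
    finally show ?thesis .
  qed
  define g where "g b = l2inner mu f (?t b)" for b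
  have coeff_lim: "(\<lambda>i. d i b) \<longlonglongrightarrow> g b" if b: "b \<in> Ip p nrm" for b
  proof -
    obtain k where k: "supp_ball k (?t b)" using t_supp by blast
    note inner = l2inner_loc_const[OF _ loc_const_translate[OF phi(1)] k]
    have "(\<lambda>i. l2inner mu (F i) (?t b)) \<longlonglongrightarrow> g b"
      unfolding inner[OF F_lc] g_def inner[OF f(2)] by (intro tendsto_intros pointwise)
    then show ?thesis by (simp add: coeff[OF b])
  qed
  \<comment> \<open>These are the elements of \<open>Ip p nrm\<close> of norm at most p^l; only
    their translates are seen on the ball of radius p^l.\<close>
  define G where "G = (\<lambda>j. of_nat j / of_nat p ^ l :: 'a) ` {..<p ^ l}"
  have inj: "inj_on (\<lambda>j. of_nat j / of_nat p ^ l :: 'a) {..<p ^ l}"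
    by (auto simp: inj_on_def)
  have G: "a \<in> Ip p nrm" if "a \<in> G" for a using that by (auto simp: G_def Ip_iff)
  have "f x = (\<Sum>a\<in>G. g a * phi (x - a))" if x: "nrm x \<le> real p ^ l" for x
  proof (rule LIMSEQ_unique[OF pointwise])
    have "F i x = (\<Sum>a\<in>G. d i a * phi (x - a))" for i
    proof -
      have out: "phi (x - a) = 0" if "a \<in> A i" "a \<notin> G" for a
      proof (rule ccontr)
        assume "phi (x - a) \<noteq> 0"
        then have "nrm (x - a) \<le> real p ^ l" using supp_ballD[OF supp_ball_mono[OF phi(2) n]] by blast
        then have "nrm a \<le> real p ^ l" using nrm_diff_leI[OF x, of "x - a"] by simp
        then have "a \<in> G" using Ip_ball[of a l] A(2) that(1) by (auto simp: G_def)
        then show False using that by simp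
      qed
      have "F i x = (\<Sum>a\<in>A i \<union> G. d i a * phi (x - a))"
        unfolding Fi using A(1) by (intro sum.mono_neutral_cong_left) (auto simp: d_def G_def)
      also have "\<dots> = (\<Sum>a\<in>G. d i a * phi (x - a))"
        using A(1) out by (intro sum.mono_neutral_right) (auto simp: G_def)
      finally show ?thesis .
    qed
    then show "(\<lambda>i. F i x) \<longlonglongrightarrow> (\<Sum>a\<in>G. g a * phi (x - a))"
      using coeff_lim G by (auto intro!: tendsto_intros)
  qed
  then have "f x = (\<Sum>j<p ^ l. g (of_nat j / of_nat p ^ l) * phi (x - of_nat j / of_nat p ^ l))"
    if "nrm x \<le> real p ^ l" for x
    using that by (simp add: G_def sum.reindex[OF inj])
  then show ?thesis by (intro exI[of _ "\<lambda>j. g (of_nat j / of_nat p ^ l)"]) blast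
qed

section \<open>From nested spaces to the refinement equation\<close>

lemma translate_in_V0:
  assumes "scaling_fun p nrm mu V phi" "loc_const m phi" "supp_ball n phi" "a \<in> Ip p nrm"
  shows "(\<lambda>x. phi (x - a)) \<in> V 0"
proof -
  obtain k where "supp_ball k (\<lambda>x. phi (x - a))"
    using nrm_bounded[of a n] supp_ball_translate[OF assms(3)] by blast
  then have "sqint mu (\<lambda>x. phi (x - a))"
    using sqint_loc_const loc_const_translate[OF assms(2)] by blast
  moreover have "(\<lambda>x. phi (x - a)) \<in> cspan {(\<lambda>x. phi (x - a)) | a. a \<in> Ip p nrm}"
    unfolding cspan_def using assms(4)
    by (intro CollectI exI[of _ "{\<lambda>x. phi (x - a)}"] exI[of _ "\<lambda>_. 1"]) auto
  ultimately show ?thesis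
    using assms(1) unfolding scaling_fun_def l2closure_def
    by (auto simp: l2norm_def intro!: exI[of _ "\<lambda>_ x. phi (x - a)"])
qed

text \<open>phi(x - a) lies in V_0, hence in V_1, so phi(p x - a) lies in V_0 and expands in
  translates of phi. Evaluation at the points k / p^(n + 1) gives the discrete relation.\<close>

lemma refinement_equation:
  assumes V: "is_MRA p nrm mu V" "orth_scaling_fun p nrm mu V phi"
    and phi: "loc_const m phi" "supp_ball n phi" and s: "s < p ^ n"
  shows "\<exists>g. \<forall>k::int. phi (of_int (k - int s) / of_nat p ^ n) = (\<Sum>j<p * p ^ n. g j *
    (if int p dvd k - int j then phi (of_int ((k - int j) div int p) / of_nat p ^ n) else 0))"
proof -
  define a :: 'a where "a = of_nat s / of_nat p ^ n"
  define f where "f x = phi (of_nat p * x - a)" for x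
  have a: "a \<in> Ip p nrm" using s by (auto simp: a_def Ip_iff)
  have na: "nrm a \<le> real p ^ n"
    using nrm_of_nat_le_1[of s] by (simp add: a_def nrm_divide field_simps)
  have scal: "scaling_fun p nrm mu V phi" using V(2) by (simp add: orth_scaling_fun_def)
  have "(\<lambda>x. phi (x - a)) \<in> V (0 + 1)"
    using V(1) translate_in_V0[OF scal phi a] unfolding is_MRA_def by blast
  moreover have "(\<lambda>x. f (inverse (of_nat p) * x)) = (\<lambda>x. phi (x - a))"
    by (simp add: f_def flip: mult.assoc)
  ultimately have "f \<in> V 0" using V(1) unfolding is_MRA_def by metis
  then have fV: "f \<in> l2closure mu (cspan {(\<lambda>x. phi (x - a)) | a. a \<in> Ip p nrm})"
    using scal by (simp add: scaling_fun_def)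
  have f_lc: "loc_const m f"
    unfolding loc_const_def
  proof (intro allI impI)
    fix x y assume xy: "nrm (x - y) \<le> inverse (real p ^ m)"
    have "of_nat p * x - a - (of_nat p * y - a) = of_nat p * (x - y)" by (simp add: algebra_simps)
    then have "nrm (of_nat p * x - a - (of_nat p * y - a)) = inverse (real p) * nrm (x - y)"
      by (simp only: nrm_mult nrm_p)
    also have "\<dots> \<le> 1 * nrm (x - y)"
      using p_ge_2 by (intro mult_right_mono) (auto simp: inverse_le_1_iff)
    finally show "f x = f y" unfolding f_def using loc_constD[OF phi(1)] xy by simp
  qed
  \<comment> \<open>Dilation by p enlarges the radius by the factor p; this is why p^(n + 1)
    translates occur.\<close>
  have f_supp: "supp_ball (Suc n) f"
    unfolding supp_ball_def
  proof (intro allI impI)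
    fix x assume "f x \<noteq> 0"
    then have "nrm (of_nat p * x - a) \<le> real p ^ n" using supp_ballD[OF phi(2)] by (simp add: f_def)
    then have "nrm (of_nat p * x) \<le> real p ^ n" using nrm_add_leI[OF _ na] by fastforce
    then show "nrm x \<le> real p ^ Suc n" by (simp add: nrm_mult field_simps)
  qed
  have orth: "l2inner mu (\<lambda>x. phi (x - a)) (\<lambda>x. phi (x - b)) = (if a = b then 1 else 0)"
    if "a \<in> Ip p nrm" "b \<in> Ip p nrm" for a b
    using V(2) that by (simp add: orth_scaling_fun_def)
  obtain g where g: "\<And>x. nrm x \<le> real p ^ Suc n \<Longrightarrow>
      f x = (\<Sum>j<p ^ Suc n. g j * phi (x - of_nat j / of_nat p ^ Suc n))"
    using l2closure_cspan_translates[OF phi orth fV f_lc f_supp] by auto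
  have "phi (of_int (k - int s) / of_nat p ^ n) = (\<Sum>j<p * p ^ n. g j *
    (if int p dvd k - int j then phi (of_int ((k - int j) div int p) / of_nat p ^ n) else 0))" for k
  proof -
    define x :: 'a where "x = of_int k / of_nat p ^ Suc n"
    have "nrm x \<le> real p ^ Suc n"
      using nrm_of_int_le_1[of k] unfolding x_def nrm_divide nrm_p_power by (simp add: field_simps)
    note g[OF this]
    moreover have "f x = phi (of_int (k - int s) / of_nat p ^ n)"
      using p_ge_2 by (simp add: f_def x_def a_def diff_divide_distrib)
    moreover have "phi (x - of_nat j / of_nat p ^ Suc n)
        = (if int p dvd k - int j then phi (of_int ((k - int j) div int p) / of_nat p ^ n) else 0)" for j
    proof -
      have xj: "x - of_nat j / of_nat p ^ Suc n = of_int (k - int j) / of_nat p ^ Suc n"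
        by (simp add: x_def diff_divide_distrib)
      show ?thesis
      proof (cases "int p dvd k - int j")
        case True
        then obtain t where "k - int j = int p * t" by blast
        then show ?thesis unfolding xj by simp
      next
        case False
        \<comment> \<open>Where p does not divide k - j, the argument therefore has norm above p^n
          and phi vanishes there; hence the 0 in the statement.\<close>
        have "int p ^ 1 dvd k - int j" if "nrm (of_int (k - int j) / of_nat p ^ Suc n) \<le> real p ^ n"
        proof -
          have "nrm (of_int (k - int j)) \<le> inverse (real p ^ 1)"
            using that unfolding nrm_divide nrm_p_power by (simp add: field_simps)
          then show ?thesis by (simp only: nrm_of_int_le_iff)
        qed
        then show ?thesis using False supp_ballD[OF phi(2)] unfolding xj by auto
      qed
    qed
    ultimately show ?thesis by simp
  qed
  then show ?thesis by blast
qed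

end

theorem theorem8:
  fixes p :: nat and nrm :: "'a::field_char_0 \<Rightarrow> real" and mu :: "'a measure"
    and V :: "int \<Rightarrow> ('a \<Rightarrow> complex) set" and phi :: "'a \<Rightarrow> complex"
    and N M :: int
  assumes "is_Qp p nrm"
    and "is_haar p nrm mu"
    and "phi \<in> DNM p nrm N M"
    and "is_MRA p nrm mu V"
    and "orth_scaling_fun p nrm mu V phi"
    and "fourier p nrm mu phi 0 \<noteq> 0"
  shows "{xi. fourier p nrm mu phi xi \<noteq> 0} \<subseteq> pball p nrm 0 0"
proof
  interpret padic_haar p nrm mu
    using assms(1,2) by unfold_locales
  fix xi assume "xi \<in> {xi. fourier p nrm mu phi xi \<noteq> 0}"
  then have xi: "fourier p nrm mu phi xi \<noteq> 0" by simp
  \<comment> \<open>A negative N is replaced by 0, which only enlarges the supporting ball.\<close>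
  define n where "n = nat N"
  \<comment> \<open>\<open>m\<close> is large enough for both phi and the character x -> chi(xi x)
    to be constant on balls of radius p^-m.\<close>
  obtain m where m: "nrm xi \<le> real p ^ m" "nat M \<le> m" using nrm_bounded by blast
  have phi: "loc_const m phi" "supp_ball n phi"
    using DNM_loc_const[OF assms(3), of m] DNM_supp_ball[OF assms(3), of n] m(2)
    by (simp_all add: n_def)
  define e where "e k = phi (of_int k / of_nat p ^ n)" for k
  define q where "q = p ^ (n + m)"
  define z where "z = chi p nrm (xi / of_nat p ^ n)"
  have e_nat: "e (int k - int s) = phi (of_nat k / of_nat p ^ n - of_nat s / of_nat p ^ n)" for k s
    by (simp add: e_def diff_divide_distrib)
  \<comment> \<open>The constant \<open>C\<close> is p^m because each grid ball carries measure
    p^-m.\<close>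
  have "z ^ p ^ n = 1"
  proof (rule orthogonal_refinable_spectrum[where e = e and q = q and C = "of_nat p ^ m"])
    show "p \<ge> 2" by (rule p_ge_2)
    show "q > 0" "p ^ n > 0" by (simp_all add: q_def)
    show "e (k + int q) = e k" for k
      unfolding e_def by (rule loc_constD[OF phi(1)]) (simp add: q_def power_add add_divide_distrib)
    show "(\<Sum>k<q. e (int k - int s) * cnj (e (int k - int t))) = (if s = t then of_nat p ^ m else 0)"
      if st: "s < p ^ n" "t < p ^ n" for s t
    proof -
      let ?a = "of_nat s / of_nat p ^ n :: 'a" and ?b = "of_nat t / of_nat p ^ n :: 'a"
      have "?a \<in> Ip p nrm" "?b \<in> Ip p nrm" using st by (auto simp: Ip_iff)
      then have "(if s = t then 1 else 0) = l2inner mu (\<lambda>x. phi (x - ?a)) (\<lambda>x. phi (x - ?b))"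
        using assms(5) by (simp add: orth_scaling_fun_def)
      also have "\<dots> = (\<Sum>k<q. inverse (real p ^ m) *\<^sub>R (e (int k - int s) * cnj (e (int k - int t))))"
      proof -
        have "nrm ?b \<le> real p ^ n"
          using nrm_of_nat_le_1[of t] by (simp add: nrm_divide field_simps)
        then have "supp_ball n (\<lambda>x. phi (x - ?b))" by (intro supp_ball_translate[OF phi(2)]) auto
        then show ?thesis unfolding e_nat q_def
          by (intro l2inner_loc_const loc_const_translate phi(1))
      qed
      also have "\<dots> = inverse (real p ^ m) *\<^sub>R (\<Sum>k<q. e (int k - int s) * cnj (e (int k - int t)))"
        by (rule scaleR_right.sum[symmetric])
      finally show ?thesis by (auto simp: scaleR_conv_of_real field_simps split: if_splits)
    qed
    show "\<exists>g. \<forall>k. e (k - int s) =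
        (\<Sum>j<p * p ^ n. g j * (if int p dvd k - int j then e ((k - int j) div int p) else 0))"
      if "s < p ^ n" for s
      unfolding e_def by (rule refinement_equation[OF assms(4,5) phi that])
    show "(\<Sum>k<q. e (int k) * 1 ^ k) \<noteq> 0"
      using fourier_loc_const[OF phi, of 0] assms(6) chi_eq_1_iff[of 0] by (simp add: e_def q_def)
    show "(\<Sum>k<q. e (int k) * z ^ k) \<noteq> 0"
      using fourier_loc_const[OF phi m(1)] xi by (simp add: e_def q_def z_def)
    have "nrm (of_nat q * (xi / of_nat p ^ n)) \<le> 1"
      using m(1) by (simp add: q_def power_add nrm_mult field_simps)
    then show "z ^ q = 1" by (simp only: z_def chi_eq_1_iff flip: chi_of_nat_mult)
  qed
  \<comment> \<open>The power z^(p^n) is chi(xi), and the kernel of the character is the unit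
    ball.\<close>
  then have "chi p nrm (of_nat (p ^ n) * (xi / of_nat p ^ n)) = 1"
    by (simp only: z_def chi_of_nat_mult)
  then show "xi \<in> pball p nrm 0 0" by (simp add: chi_eq_1_iff pball_def)
qed

end
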